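(* Let $d\ge1$, let $\{\rho_n\}_{n\ge1}$ be a sequence of (strictly) positive real numbers, and let $\{B_n\}_{n\ge0}$ be the $d$-symmetric $d$-OPS defined by $B_n(x)=x^n$ for $0\le n\le d$ and $B_{n+d+1}(x)=xB_{n+d}(x)-\rho_{n+1}B_n(x)$ for $n\ge0$. For $0\le i\le d$ let $\{B_n^i\}_{n\ge0}$ be its $i$-th component and let $J_d^i$ be the monic lower Hessenberg matrix of $\{B_n^i\}_{n\ge0}$. Then for every $0\le i\le d$ and every $n\ge1$ the $n\times n$ leading principal submatrix of $J_d^i$ is an oscillation matrix, and its eigenvalues are positive and simple.
   Context: The components $\{B_n^s\}_{n\ge0}$, $0\le s\le d$, are the monic polynomial sequences determined by $B_{(d+1)n+s}(x)=x^sB_n^s(x^{d+1})$, $n\ge0$. The monic lower Hessenberg matrix of the component $\{B_n^i\}$ is the infinite lower Hessenberg matrix $J_d^i$ (with $1$'s on the superdiagonal, zeros above it) such that $x\,\mathbb B^i=J_d^i\,\mathbb B^i$, where $\mathbb B^i=(B_0^i,B_1^i,\dots)^T$. A real matrix is totally nonnegative (TN) if all its minors are nonnegative, totally positive (TP) if all its minors are strictly positive; a square matrix $A$ is an oscillation matrix if $A$ is TN and some power of $A$ is TP. *)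

theory Defs
  imports
    "Jordan_Normal_Form.Char_Poly"
    "Jordan_Normal_Form.DL_Submatrix"
begin

hide_const (open) Module.smult

definition monic_poly_seq :: "(nat \<Rightarrow> real poly) \<Rightarrow> bool" where
  "monic_poly_seq P \<longleftrightarrow> (\<forall>n. degree (P n) = n \<and> lead_coeff (P n) = 1)"

definition is_component :: "nat \<Rightarrow> (nat \<Rightarrow> real poly) \<Rightarrow> nat \<Rightarrow> (nat \<Rightarrow> real poly) \<Rightarrow> bool" where
  "is_component d B s P \<longleftrightarrow> monic_poly_seq P \<and>
     (\<forall>n. B ((d + 1) * n + s) = monom 1 s * pcompose (P n) (monom 1 (d + 1)))"

text \<open>For \<open>s \<le> d\<close> and the recurrence of interest, existence and uniqueness are proved in
  \<open>component_ex1\<close> below.\<close>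

definition component :: "nat \<Rightarrow> (nat \<Rightarrow> real poly) \<Rightarrow> nat \<Rightarrow> nat \<Rightarrow> real poly" where
  "component d B s = (THE P. is_component d B s P)"

text \<open>Infinite matrices are functions with rows and columns indexed from 0. Since row \<open>m\<close>
  vanishes to the right of column \<open>m + 1\<close>, the infinite product \<open>J P\<close> is a finite sum in each
  row.\<close>

definition is_monic_hessenberg :: "(nat \<Rightarrow> real poly) \<Rightarrow> (nat \<Rightarrow> nat \<Rightarrow> real) \<Rightarrow> bool" where
  "is_monic_hessenberg P J \<longleftrightarrow>
     (\<forall>m. J m (m + 1) = 1) \<and> (\<forall>m k. m + 1 < k \<longrightarrow> J m k = 0) \<and>
     (\<forall>m. [:0, 1:] * P m = (\<Sum>k\<le>m + 1. smult (J m k) (P k)))"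

text \<open>For a monic polynomial sequence, existence and uniqueness are proved in
  \<open>monic_hessenberg_ex1\<close> below.\<close>

definition monic_hessenberg :: "(nat \<Rightarrow> real poly) \<Rightarrow> nat \<Rightarrow> nat \<Rightarrow> real" where
  "monic_hessenberg P = (THE J. is_monic_hessenberg P J)"

definition leading_principal :: "nat \<Rightarrow> (nat \<Rightarrow> nat \<Rightarrow> real) \<Rightarrow> real mat" where
  "leading_principal n J = mat n n (\<lambda>(k, l). J k l)"

text \<open>Minors are indexed by sets of row and column indices; the empty minor, which is 1, is
  harmlessly included.\<close>

definition totally_nonnegative :: "real mat \<Rightarrow> bool" where
  "totally_nonnegative A \<longleftrightarrow>
     (\<forall>I J. I \<subseteq> {..<dim_row A} \<longrightarrow> J \<subseteq> {..<dim_col A} \<longrightarrow> card I = card J \<longrightarrow>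
        0 \<le> det (submatrix A I J))"

definition totally_positive :: "real mat \<Rightarrow> bool" where
  "totally_positive A \<longleftrightarrow>
     (\<forall>I J. I \<subseteq> {..<dim_row A} \<longrightarrow> J \<subseteq> {..<dim_col A} \<longrightarrow> card I = card J \<longrightarrow>
        0 < det (submatrix A I J))"

text \<open>The exponent is positive: the zeroth power would make the \<open>1 \<times> 1\<close> zero matrix an
  oscillation matrix.\<close>

definition oscillation_matrix :: "real mat \<Rightarrow> bool" where
  "oscillation_matrix A \<longleftrightarrow> square_mat A \<and> totally_nonnegative A \<and>
     (\<exists>k\<ge>1. totally_positive (A ^\<^sub>m k))"

text \<open>All complex eigenvalues are considered, so reality of the spectrum is part of the claim;
  an eigenvalue is simple if its algebraic multiplicity is 1.\<close>

definition eigenvalues_positive_simple :: "real mat \<Rightarrow> bool" where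
  "eigenvalues_positive_simple A \<longleftrightarrow>
     (\<forall>z. eigenvalue (map_mat complex_of_real A) z \<longrightarrow>
        (\<exists>r>0. z = complex_of_real r) \<and>
        order z (char_poly (map_mat complex_of_real A)) = 1)"

lemma div_block: "r < k \<Longrightarrow> (r + q * k) div k = q" for r k q :: nat
  by simp

lemma mod_block: "r < k \<Longrightarrow> (r + q * k) mod k = r" for r k q :: nat
  by simp

lemma component_exists_aux:
  fixes B :: "nat \<Rightarrow> real poly"
  assumes init: "\<And>n. n \<le> d \<Longrightarrow> B n = monom 1 n"
    and rec: "\<And>n. B (n + d + 1) = [:0, 1:] * B (n + d) - smult (\<rho> (n + 1)) (B n)"
  shows "\<exists>Q. degree Q = m div (d + 1) \<and> lead_coeff Q = 1 \<and>
           B m = monom 1 (m mod (d + 1)) * pcompose Q (monom 1 (d + 1))"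
proof (induction m rule: less_induct)
  case (less m)
  show ?case
  proof (cases "m \<le> d")
    case True
    then show ?thesis by (intro exI[of _ 1]) (simp add: init)
  next
    case False
    then obtain n where m: "m = n + d + 1"
      using that[of "m - (d + 1)"] by simp
    define q s where "q = n div (d + 1)" and "s = n mod (d + 1)"
    have n: "n = (d + 1) * q + s"
      unfolding q_def s_def by (simp only: mult_div_mod_eq)
    have sd: "s \<le> d"
      unfolding s_def using mod_less_divisor[of "d + 1" n] by simp
    have mdiv: "m div (d + 1) = q + 1" and mmod: "m mod (d + 1) = s"
      unfolding m q_def s_def using div_add_self2[of "d + 1" n] mod_add_self2[of n "d + 1"]
      by (simp_all only: add.assoc)
    obtain Q0 where Q0: "degree Q0 = q" "B n = monom 1 s * pcompose Q0 (monom 1 (d + 1))"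
      using less.IH[of n] m unfolding q_def s_def by auto
    have X: "[:0, 1:] = (monom 1 1 :: real poly)" by (simp add: monom_Suc)
    have "\<exists>Q1. degree Q1 = q + 1 \<and> lead_coeff Q1 = 1 \<and>
        [:0, 1:] * B (n + d) = monom 1 s * pcompose Q1 (monom 1 (d + 1))"
    proof (cases "s = 0")
      case True
      have eq: "n + d = d + q * (d + 1)" using n True by simp
      have "(n + d) div (d + 1) = q" "(n + d) mod (d + 1) = d"
        unfolding eq by (rule div_block mod_block, simp)+
      then obtain Q where Q: "degree Q = q" "lead_coeff Q = 1"
        "B (n + d) = monom 1 d * pcompose Q (monom 1 (d + 1))"
        using less.IH[of "n + d"] m by auto
      have Qn: "Q \<noteq> 0" using Q(2) by auto
      have e: "[:0, 1:] * B (n + d) = monom 1 s * pcompose ([:0, 1:] * Q) (monom 1 (d + 1))"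
      proof -
        have "pcompose (monom 1 1) (monom 1 (d + 1)) = (monom 1 (d + 1) :: real poly)"
          unfolding X[symmetric] by (simp add: pcompose_pCons)
        then show ?thesis
          unfolding Q(3) True X pcompose_mult mult.assoc[symmetric] mult_monom
          by (simp add: monom_0 del: monom_Suc)
      qed
      have "degree ([:0, 1:] * Q) = q + 1" "lead_coeff ([:0, 1:] * Q) = 1"
        using Q(1,2) Qn by (auto simp: degree_mult_eq lead_coeff_mult)
      with e show ?thesis by blast
    next
      case False
      have eq: "n + d = (s - 1) + (q + 1) * (d + 1)" using n False by simp
      have lt: "s - 1 < d + 1" using sd by simp
      have "(n + d) div (d + 1) = q + 1" "(n + d) mod (d + 1) = s - 1"
        unfolding eq by (rule div_block[OF lt], rule mod_block[OF lt])
      then obtain Q where Q: "degree Q = q + 1" "lead_coeff Q = 1"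
        "B (n + d) = monom 1 (s - 1) * pcompose Q (monom 1 (d + 1))"
        using less.IH[of "n + d"] m by auto
      have "[:0, 1:] * B (n + d) = monom 1 s * pcompose Q (monom 1 (d + 1))"
        unfolding Q(3) X mult.assoc[symmetric] mult_monom using False by simp
      with Q show ?thesis by blast
    qed
    then obtain Q1 where Q1: "degree Q1 = q + 1" "lead_coeff Q1 = 1"
      "[:0, 1:] * B (n + d) = monom 1 s * pcompose Q1 (monom 1 (d + 1))" by blast
    define Q where "Q = Q1 - smult (\<rho> (n + 1)) Q0"
    have lt: "degree (smult (\<rho> (n + 1)) Q0) < degree Q1"
      using Q0(1) Q1(1) by (simp add: le_less_trans[OF degree_smult_le])
    then have "degree Q = q + 1"
      unfolding Q_def diff_conv_add_uminus using Q1(1) by (subst degree_add_eq_left) auto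
    moreover have "lead_coeff Q = 1"
      using calculation Q1(1,2) Q0(1) unfolding Q_def by (simp add: coeff_eq_0)
    moreover have "B m = monom 1 s * pcompose Q (monom 1 (d + 1))"
      unfolding m rec Q1(3) unfolding Q0(2) Q_def
      by (simp add: pcompose_diff pcompose_smult right_diff_distrib)
    ultimately show ?thesis unfolding mdiv mmod by blast
  qed
qed

lemma component_ex1:
  fixes B :: "nat \<Rightarrow> real poly"
  assumes init: "\<And>n. n \<le> d \<Longrightarrow> B n = monom 1 n"
    and rec: "\<And>n. B (n + d + 1) = [:0, 1:] * B (n + d) - smult (\<rho> (n + 1)) (B n)"
    and s: "s \<le> d"
  shows "\<exists>!P. is_component d B s P"
proof (rule ex_ex1I)
  have "\<exists>Q. degree Q = n \<and> lead_coeff Q = 1 \<and>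
          B ((d + 1) * n + s) = monom 1 s * pcompose Q (monom 1 (d + 1))" for n
  proof -
    have "s < d + 1" using s by simp
    then have "((d + 1) * n + s) div (d + 1) = n" "((d + 1) * n + s) mod (d + 1) = s"
      using div_block[of s "d + 1" n] mod_block[of s "d + 1" n] by (simp_all only: ac_simps)
    then show ?thesis using component_exists_aux[of d B \<rho> "(d + 1) * n + s", OF init rec] by metis
  qed
  then obtain P where "\<And>n. degree (P n) = n \<and> lead_coeff (P n) = 1 \<and>
          B ((d + 1) * n + s) = monom 1 s * pcompose (P n) (monom 1 (d + 1))" by metis
  then show "\<exists>P. is_component d B s P"
    unfolding is_component_def monic_poly_seq_def by blast
next
  fix P Q assume "is_component d B s P" "is_component d B s Q"
  then have "monom 1 s * pcompose (P n) (monom 1 (d + 1)) =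
      monom 1 s * pcompose (Q n) (monom 1 (d + 1))" for n
    unfolding is_component_def by metis
  then have "pcompose (P n) (monom 1 (d + 1)) = pcompose (Q n) (monom 1 (d + 1))" for n
    by (simp only: mult_cancel_left monom_eq_0_iff) simp
  then have "pcompose (P n - Q n) (monom 1 (d + 1)) = 0" for n
    by (simp only: pcompose_diff diff_self)
  then have "P n - Q n = 0" for n
    by (rule pcompose_eq_0) (simp add: degree_monom_eq)
  then show "P = Q" by auto
qed

lemma monic_poly_seq_expansion:
  assumes P: "monic_poly_seq P" and "degree p \<le> N"
  shows "\<exists>c. p = (\<Sum>k\<le>N. smult (c k) (P k))"
  using assms(2)
proof (induction N arbitrary: p)
  case 0
  have "degree (P 0) = 0" "coeff (P 0) 0 = 1"
    using P unfolding monic_poly_seq_def by metis+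
  moreover obtain a where "P 0 = [:a:]" using calculation(1) by (rule degree_eq_zeroE)
  ultimately have "P 0 = 1" by simp
  moreover obtain b where "p = [:b:]" using 0 by (auto intro: degree_eq_zeroE)
  ultimately have "p = (\<Sum>k\<le>0. smult ((\<lambda>_. b) k) (P k))" by simp
  then show ?case by (intro exI[of _ "\<lambda>_. b"])
next
  case (Suc N)
  let ?a = "coeff p (Suc N)"
  have d: "degree (P (Suc N)) = Suc N" "coeff (P (Suc N)) (Suc N) = 1"
    using P unfolding monic_poly_seq_def by metis+
  have "degree (p - smult ?a (P (Suc N))) \<le> N"
  proof (rule degree_le, intro allI impI)
    fix i assume "N < i"
    then consider "i = Suc N" | "Suc N < i" by linarith
    then show "coeff (p - smult ?a (P (Suc N))) i = 0"
      by cases (use d Suc.prems in \<open>auto simp: coeff_eq_0\<close>)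
  qed
  then obtain c where c: "p - smult ?a (P (Suc N)) = (\<Sum>k\<le>N. smult (c k) (P k))"
    using Suc.IH by blast
  have "p = (\<Sum>k\<le>Suc N. smult ((c(Suc N := ?a)) k) (P k))"
    using c by (simp add: algebra_simps)
  then show ?case by blast
qed

lemma monic_poly_seq_coeff_sum:
  assumes P: "monic_poly_seq P"
  shows "coeff (\<Sum>k\<le>N. smult (c k) (P k)) N = c N"
proof -
  have d: "\<And>k. degree (P k) = k" "coeff (P N) N = 1"
    using P unfolding monic_poly_seq_def by metis+
  have "coeff (\<Sum>k\<le>N. smult (c k) (P k)) N = (\<Sum>k\<le>N. if k = N then c N else 0)"
    unfolding coeff_sum by (rule sum.cong) (auto simp: d coeff_eq_0)
  then show ?thesis by simp
qed

lemma monic_poly_seq_independent: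
  assumes P: "monic_poly_seq P" and "(\<Sum>k\<le>N. smult (c k) (P k)) = 0" and "k \<le> N"
  shows "c k = 0"
  using assms(2,3)
proof (induction N)
  case 0
  then show ?case using monic_poly_seq_coeff_sum[OF P, of c 0] by (simp only: coeff_0 le_zero_eq)
next
  case (Suc N)
  have "c (Suc N) = 0" using monic_poly_seq_coeff_sum[OF P, of c "Suc N"] Suc.prems(1)
    by (simp only: coeff_0)
  then show ?case using Suc by (cases "k = Suc N") auto
qed

lemma monic_hessenberg_ex1:
  assumes P: "monic_poly_seq P"
  shows "\<exists>!J. is_monic_hessenberg P J"
proof (rule ex_ex1I)
  have d: "degree (P m) = m" "coeff (P m) m = 1" for m
    using P unfolding monic_poly_seq_def by metis+
  have "degree ([:0, 1:] * P m) \<le> m + 1" for m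
    by (rule order.trans[OF degree_mult_le]) (simp add: d)
  then have "\<exists>c. [:0, 1:] * P m = (\<Sum>k\<le>m + 1. smult (c k) (P k))" for m
    by (rule monic_poly_seq_expansion[OF P])
  then obtain c where c: "\<And>m. [:0, 1:] * P m = (\<Sum>k\<le>m + 1. smult (c m k) (P k))" by metis
  define J where "J = (\<lambda>m k. if k \<le> m + 1 then c m k else 0)"
  have "c m (m + 1) = 1" for m
    using monic_poly_seq_coeff_sum[OF P, of "c m" "m + 1"] d unfolding c[symmetric] by simp
  then have "is_monic_hessenberg P J"
    unfolding is_monic_hessenberg_def c J_def by (auto intro!: sum.cong)
  then show "\<exists>J. is_monic_hessenberg P J" by blast
next
  fix J K assume JK: "is_monic_hessenberg P J" "is_monic_hessenberg P K"
  have "J m k = K m k" for m k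
  proof (cases "k \<le> m + 1")
    case True
    have "(\<Sum>k\<le>m + 1. smult (J m k - K m k) (P k)) = 0"
    proof -
      have "(\<Sum>k\<le>m + 1. smult (J m k) (P k)) = (\<Sum>k\<le>m + 1. smult (K m k) (P k))"
        using JK unfolding is_monic_hessenberg_def by metis
      then show ?thesis by (simp only: smult_diff_left sum_subtractf diff_self)
    qed
    from monic_poly_seq_independent[OF P this True] show ?thesis by simp
  next
    case False
    then have "m + 1 < k" by simp
    then have "J m k = 0" "K m k = 0" using JK unfolding is_monic_hessenberg_def by blast+
    then show ?thesis by simp
  qed
  then show "J = K" by blast
qed

end

(* Write y = x^(d+1) and let P^s be the components. The recurrence of B splits into
     P^s_n = P^(s+1)_n + rho P^(s+1)_(n-1)  (s < d)   and   y P^d_n = P^0_(n+1) + rho P^0_n,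
   so J^i is a cyclic product L_(i+1) ... L_d U L_1 ... L_i of positive bidiagonal matrices, and its
   n x n leading block is that of the product of the (n+1) x (n+1) truncations. The determinant of a
   square submatrix of a bidiagonal matrix is the product of its diagonal entries; by Cauchy-Binet
   the block is totally nonnegative, its principal minors are positive, and so are the minors whose row and column sets
   differ by moving one index to a neighbouring position. Chaining such moves makes all minors of a
   high power positive.

   The characteristic polynomial of the block is P^i_n. That its zeros are real and simple follows
   from one induction along the recurrence for an alternating form: Im (g(z) cnj f(z)) at a point z
   of the upper half-plane excludes nonreal zeros, and the Wronskian at a real point excludes
   double zeros. Along the recurrence (-1)^n P^s_n stays positive on the nonpositive axis. *)

theory Submission imports Defs begin

section \<open>Minors\<close>

abbreviation minor :: "'a :: comm_ring_1 mat \<Rightarrow> nat set \<Rightarrow> nat set \<Rightarrow> 'a" where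
  "minor A I J \<equiv> det (submatrix A I J)"

section \<open>Increasing enumerations of index sets and the entries of submatrices\<close>

lemma pick_strict_mono_image:
  assumes mono: "\<And>k l. k < l \<Longrightarrow> l < m \<Longrightarrow> g k < g l" and "k < m"
  shows "pick (g ` {..<m}) k = (g k :: nat)"
proof -
  \<comment> \<open>\<open>pick\<close> locates a member of a set by the number of members below it;
    below \<open>g k\<close> lie exactly \<open>g 0\<close>, ..., \<open>g (k - 1)\<close>.\<close>
  have "{a \<in> g ` {..<m}. a < g k} = g ` {..<k}"
  proof -
    have "l < k" if "l < m" "g l < g k" for l
      using that mono[of k l] by (cases l k rule: linorder_cases) auto
    then show ?thesis using mono \<open>k < m\<close> by auto
  qed
  moreover have "inj_on g {..<k}"
  proof (rule inj_onI)
    fix x y assume "x \<in> {..<k}" "y \<in> {..<k}" "g x = g y"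
    then show "x = y" using mono[of x y] mono[of y x] \<open>k < m\<close>
      by (cases x y rule: linorder_cases) auto
  qed
  ultimately have "card {a \<in> g ` {..<m}. a < g k} = k" by (simp add: card_image)
  then show ?thesis using pick_card_in_set[of "g k" "g ` {..<m}"] \<open>k < m\<close> by auto
qed

lemma pick_less:
  assumes "I \<subseteq> {..<n}" "k < card I"
  shows "pick I k < n"
  using pick_in_set_le[OF assms(2)] assms(1) by auto

lemma inj_on_pick: "inj_on (pick K) {..<card K}"
proof (rule inj_onI)
  fix x y assume "x \<in> {..<card K}" "y \<in> {..<card K}" "pick K x = pick K y"
  then show "x = y" using pick_mono_le[of y K x] pick_mono_le[of x K y]
    by (cases x y rule: linorder_cases) auto
qed

lemma pick_image:
  assumes "finite K"
  shows "pick K ` {..<card K} = K"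
  by (rule card_subset_eq[OF assms]) (auto simp: pick_in_set_le card_image[OF inj_on_pick])

lemma minor_eq_det_mat:
  assumes "A \<in> carrier_mat r c" "I \<subseteq> {..<r}" "J \<subseteq> {..<c}" "card I = m" "card J = m"
  shows "minor A I J = det (mat m m (\<lambda>(i, j). A $$ (pick I i, pick J j)))"
proof -
  have "{i. i < dim_row A \<and> i \<in> I} = I" "{j. j < dim_col A \<and> j \<in> J} = J"
    using assms by auto
  then show ?thesis unfolding submatrix_def using assms by simp
qed

text \<open>The two matrices may differ in size, so that a minor of a leading block can be compared
  with the same minor of the whole matrix.\<close>

lemma minor_cong:
  assumes "A \<in> carrier_mat r c" "B \<in> carrier_mat r' c'"
    and "I \<subseteq> {..<r}" "J \<subseteq> {..<c}" "I \<subseteq> {..<r'}" "J \<subseteq> {..<c'}" "card I = card J"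
    and eq: "\<And>i j. i \<in> I \<Longrightarrow> j \<in> J \<Longrightarrow> A $$ (i, j) = B $$ (i, j)"
  shows "minor A I J = minor B I J"
proof -
  have "mat (card J) (card J) (\<lambda>(i, j). A $$ (pick I i, pick J j)) =
        mat (card J) (card J) (\<lambda>(i, j). B $$ (pick I i, pick J j))"
    using assms(7) by (intro cong_mat) (auto intro!: eq pick_in_set_le)
  then show ?thesis
    using minor_eq_det_mat[OF assms(1,3,4,7) refl] minor_eq_det_mat[OF assms(2,5,6,7) refl] by simp
qed

section \<open>The Cauchy-Binet formula\<close>

text \<open>A product of row sums is a sum over choices \<open>f\<close> of one summand per row;
  exchanging this sum with the Leibniz sum reassembles a determinant for every
  \<open>f\<close>.\<close>

lemma det_mat_sum_products:
  fixes a b :: "nat \<Rightarrow> nat \<Rightarrow> 'a :: comm_ring_1"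
  shows "det (mat m m (\<lambda>(i, j). \<Sum>k<n. a i k * b k j)) =
    (\<Sum>f \<in> {0..<m} \<rightarrow>\<^sub>E {..<n}. (\<Prod>i = 0..<m. a i (f i)) * det (mat m m (\<lambda>(i, j). b (f i) j)))"
proof -
  have det: "det (mat m m (\<lambda>(i, j). g i j)) =
      (\<Sum>p | p permutes {0..<m}. signof p * (\<Prod>i = 0..<m. g i (p i)))" for g :: "nat \<Rightarrow> nat \<Rightarrow> 'a"
    by (subst det_def'[of _ m]) (auto intro!: sum.cong prod.cong arg_cong2[where f = "(*)"])
  have "det (mat m m (\<lambda>(i, j). \<Sum>k<n. a i k * b k j)) =
      (\<Sum>p | p permutes {0..<m}. signof p *
        (\<Sum>f \<in> {0..<m} \<rightarrow>\<^sub>E {..<n}. \<Prod>i = 0..<m. a i (f i) * b (f i) (p i)))"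
    unfolding det by (subst prod_sum_PiE) auto
  also have "\<dots> = (\<Sum>p | p permutes {0..<m}. \<Sum>f \<in> {0..<m} \<rightarrow>\<^sub>E {..<n}.
      (\<Prod>i = 0..<m. a i (f i)) * (signof p * (\<Prod>i = 0..<m. b (f i) (p i))))"
    by (simp add: sum_distrib_left prod.distrib algebra_simps)
  also have "\<dots> = (\<Sum>f \<in> {0..<m} \<rightarrow>\<^sub>E {..<n}. \<Sum>p | p permutes {0..<m}.
      (\<Prod>i = 0..<m. a i (f i)) * (signof p * (\<Prod>i = 0..<m. b (f i) (p i))))"
    by (rule sum.swap)
  also have "\<dots> = (\<Sum>f \<in> {0..<m} \<rightarrow>\<^sub>E {..<n}. (\<Prod>i = 0..<m. a i (f i)) *
      det (mat m m (\<lambda>(i, j). b (f i) j)))"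
    unfolding det by (simp add: sum_distrib_left)
  finally show ?thesis .
qed

text \<open>Sort the choice functions \<open>f\<close> of \<open>det_mat_sum_products\<close> by
  their image \<open>K\<close>; for fixed \<open>K\<close> they differ by a permutation, and summing
  over it gives the two minors.\<close>

lemma Cauchy_Binet:
  fixes A B :: "'a :: comm_ring_1 mat"
  assumes A: "A \<in> carrier_mat r n" and B: "B \<in> carrier_mat n c"
    and I: "I \<subseteq> {..<r}" and J: "J \<subseteq> {..<c}" and m: "card I = m" "card J = m"
  shows "minor (A * B) I J = (\<Sum>K | K \<subseteq> {..<n} \<and> card K = m. minor A I K * minor B K J)"
proof -
  define a where "a i k = A $$ (pick I i, k)" for i k
  define b where "b k j = B $$ (k, pick J j)" for k j
  define h where "h f = (\<Prod>i = 0..<m. a i (f i)) * det (mat m m (\<lambda>(i, j). b (f i) j))"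
    for f :: "nat \<Rightarrow> nat"
  let ?F = "{0..<m} \<rightarrow>\<^sub>E {..<n}"
  let ?K = "{K. K \<subseteq> {..<n} \<and> card K = m}"
  let ?P = "{p. p permutes {0..<m}}"
  have fin: "finite K" if "K \<in> ?K" for K
    using that finite_subset by blast
  have Kpick: "pick K ` {0..<m} = K" "inj_on (pick K) {0..<m}" if "K \<in> ?K" for K
    using pick_image[OF fin[OF that]] inj_on_pick[of K] that by (auto simp: atLeast0LessThan)
  have AB: "A * B \<in> carrier_mat r c" using A B by simp
  have "minor (A * B) I J = det (mat m m (\<lambda>(i, j). \<Sum>k<n. a i k * b k j))"
    unfolding minor_eq_det_mat[OF AB I J m]
  proof (intro arg_cong[where f = det] cong_mat refl)
    fix i j assume "i < m" "j < m"
    then show "(case (i, j) of (i, j) \<Rightarrow> (A * B) $$ (pick I i, pick J j)) =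
        (case (i, j) of (i, j) \<Rightarrow> \<Sum>k<n. a i k * b k j)"
      using A B pick_less[OF I, of i] pick_less[OF J, of j] m
      by (auto simp: scalar_prod_def a_def b_def atLeast0LessThan)
  qed
  also have "\<dots> = sum h ?F" unfolding det_mat_sum_products h_def ..
  \<comment> \<open>A choice function that is not injective produces two equal rows.\<close>
  also have "\<dots> = sum h {f \<in> ?F. inj_on f {0..<m}}"
  proof (rule sum.mono_neutral_right)
    show "\<forall>f \<in> ?F - {f \<in> ?F. inj_on f {0..<m}}. h f = 0"
    proof
      fix f assume "f \<in> ?F - {f \<in> ?F. inj_on f {0..<m}}"
      then obtain i j where ij: "i < m" "j < m" "i \<noteq> j" "f i = f j" by (auto simp: inj_on_def)
      then have "det (mat m m (\<lambda>(i, j). b (f i) j)) = 0"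
        by (intro det_identical_rows[of _ m i j]) (auto intro: eq_vecI)
      then show "h f = 0" unfolding h_def by simp
    qed
  qed (auto simp: finite_PiE)
  \<comment> \<open>An injective \<open>f\<close> amounts to its image \<open>K\<close> together
    with the permutation \<open>p\<close> that sends \<open>i\<close> to the rank of
    \<open>f i\<close> in \<open>K\<close>.\<close>
  also have "\<dots> = (\<Sum>(K, p) \<in> ?K \<times> ?P. h (restrict (\<lambda>i. pick K (p i)) {0..<m}))"
  proof (rule sum.reindex_bij_witness[where
        i = "\<lambda>(K, p). restrict (\<lambda>i. pick K (p i)) {0..<m}" and
        j = "\<lambda>f. (f ` {0..<m}, \<lambda>i. if i < m then card {a \<in> f ` {0..<m}. a < f i} else i)"])
    fix f assume "f \<in> {f \<in> ?F. inj_on f {0..<m}}"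
    then have f: "f \<in> ?F" "inj_on f {0..<m}" by auto
    \<comment> \<open>Outside the range \<open>p\<close> has to be the identity, as
      \<open>permutes\<close> demands.\<close>
    define p where "p i = (if i < m then card {a \<in> f ` {0..<m}. a < f i} else i)" for i
    have pick_p: "pick (f ` {0..<m}) (p i) = f i" if "i < m" for i
      using that unfolding p_def by (simp add: pick_card_in_set)
    have K: "f ` {0..<m} \<in> ?K" using f by (auto simp: card_image)
    have "p permutes {0..<m}"
    proof (rule bij_imp_permutes)
      have "inj_on p {0..<m}"
        using f(2) pick_p by (metis atLeastLessThan_iff inj_on_def)
      moreover have "p ` {0..<m} \<subseteq> {0..<m}"
      proof
        fix x assume "x \<in> p ` {0..<m}"
        then obtain i where i: "i < m" "x = p i" by auto
        have "card {a \<in> f ` {0..<m}. a < f i} < card (f ` {0..<m})"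
          using i by (intro psubset_card_mono) auto
        then show "x \<in> {0..<m}" using i f(2) unfolding p_def by (simp add: card_image)
      qed
      ultimately show "bij_betw p {0..<m} {0..<m}"
        by (simp add: bij_betw_def endo_inj_surj)
    qed (simp add: p_def)
    then show "(f ` {0..<m}, \<lambda>i. if i < m then card {a \<in> f ` {0..<m}. a < f i} else i) \<in> ?K \<times> ?P"
      using K unfolding p_def by simp
    have "restrict (\<lambda>i. pick (f ` {0..<m}) (p i)) {0..<m} = f"
    proof (rule ext)
      fix i show "restrict (\<lambda>i. pick (f ` {0..<m}) (p i)) {0..<m} i = f i"
        using pick_p[of i] PiE_arb[OF f(1), of i] by (cases "i < m") simp_all
    qed
    then show eq: "(case (f ` {0..<m}, \<lambda>i. if i < m then card {a \<in> f ` {0..<m}. a < f i} else i) of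
        (K, p) \<Rightarrow> restrict (\<lambda>i. pick K (p i)) {0..<m}) = f" unfolding p_def by simp
    then show "(case (f ` {0..<m}, \<lambda>i. if i < m then card {a \<in> f ` {0..<m}. a < f i} else i) of
        (K, p) \<Rightarrow> h (restrict (\<lambda>i. pick K (p i)) {0..<m})) = h f" by simp
  next
    fix Kp assume "Kp \<in> ?K \<times> ?P"
    then obtain K p where Kp: "Kp = (K, p)" and K: "K \<in> ?K" and p: "p permutes {0..<m}" by auto
    let ?f = "restrict (\<lambda>i. pick K (p i)) {0..<m}"
    have p_less: "p i < m" if "i < m" for i
      using permutes_in_image[OF p, of i] that by simp
    have img: "?f ` {0..<m} = K"
    proof -
      have "?f ` {0..<m} = pick K ` p ` {0..<m}" by (auto simp: image_image)
      then show ?thesis unfolding permutes_image[OF p] Kpick(1)[OF K] .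
    qed
    have "inj_on (pick K \<circ> p) {0..<m}"
      using Kpick(2)[OF K] permutes_inj_on[OF p] permutes_image[OF p] by (intro comp_inj_on) auto
    then have "inj_on ?f {0..<m}" by (simp add: inj_on_def)
    moreover have "?f \<in> ?F" using img K by (auto simp: restrict_def)
    ultimately show "(case Kp of (K, p) \<Rightarrow> restrict (\<lambda>i. pick K (p i)) {0..<m}) \<in>
        {f \<in> ?F. inj_on f {0..<m}}" unfolding Kp by simp
    have p_eq: "(if i < m then card {a \<in> K. a < ?f i} else i) = p i" for i
      using p_less card_pick_le[of "p i" K] K p by (auto simp: permutes_def)
    then show "((case Kp of (K, p) \<Rightarrow> restrict (\<lambda>i. pick K (p i)) {0..<m}) ` {0..<m},
        \<lambda>i. if i < m then card {a \<in> (case Kp of (K, p) \<Rightarrow> restrict (\<lambda>i. pick K (p i)) {0..<m}) ` {0..<m}.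
          a < (case Kp of (K, p) \<Rightarrow> restrict (\<lambda>i. pick K (p i)) {0..<m}) i} else i) = Kp"
      unfolding Kp prod.case img by simp
  qed
  also have "\<dots> = (\<Sum>K\<in>?K. \<Sum>p\<in>?P. h (restrict (\<lambda>i. pick K (p i)) {0..<m}))"
    by (rule sum.cartesian_product[symmetric])
  also have "\<dots> = (\<Sum>K\<in>?K. minor A I K * minor B K J)"
  proof (rule sum.cong[OF refl])
    fix K assume K: "K \<in> ?K"
    then have K': "K \<subseteq> {..<n}" "card K = m" by auto
    let ?A = "mat m m (\<lambda>(i, j). a i (pick K j))" and ?B = "mat m m (\<lambda>(i, j). b (pick K i) j)"
    \<comment> \<open>Sorting the rows of the second factor costs the sign of \<open>p\<close>,
      which completes the Leibniz term of the first determinant.\<close>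
    have "h (restrict (\<lambda>i. pick K (p i)) {0..<m}) =
        signof p * (\<Prod>i = 0..<m. ?A $$ (i, p i)) * det ?B" if p: "p permutes {0..<m}" for p
    proof -
      have "mat m m (\<lambda>(i, j). b (restrict (\<lambda>i. pick K (p i)) {0..<m} i) j) =
          mat m m (\<lambda>(i, j). ?B $$ (p i, j))"
        using permutes_in_image[OF p] by (intro cong_mat) auto
      then have "det (mat m m (\<lambda>(i, j). b (restrict (\<lambda>i. pick K (p i)) {0..<m} i) j)) =
          signof p * det ?B" using det_permute_rows[OF _ p, of ?B] by simp
      moreover have "(\<Prod>i = 0..<m. a i (restrict (\<lambda>i. pick K (p i)) {0..<m} i)) =
          (\<Prod>i = 0..<m. ?A $$ (i, p i))"
        using permutes_in_image[OF p] by (intro prod.cong) auto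
      ultimately show ?thesis unfolding h_def by simp
    qed
    then have "(\<Sum>p\<in>?P. h (restrict (\<lambda>i. pick K (p i)) {0..<m})) = det ?A * det ?B"
      by (subst det_def'[of ?A m]) (auto simp: sum_distrib_right intro!: sum.cong)
    then show "(\<Sum>p\<in>?P. h (restrict (\<lambda>i. pick K (p i)) {0..<m})) = minor A I K * minor B K J"
      unfolding minor_eq_det_mat[OF A I K'(1) m(1) K'(2)] minor_eq_det_mat[OF B K'(1) J K'(2) m(2)]
        a_def b_def .
  qed
  finally show ?thesis .
qed

section \<open>Minors of matrices with monotone support\<close>

text \<open>A property shared by the identity and by lower and upper bidiagonal matrices, and enough
  to evaluate all their minors.\<close>

definition monotone_support :: "'a :: zero mat \<Rightarrow> bool" where
  "monotone_support A \<longleftrightarrow>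
     (\<forall>i < dim_row A. \<forall>i' < dim_row A. \<forall>j < dim_col A. \<forall>j' < dim_col A.
        A $$ (i, j) \<noteq> 0 \<longrightarrow> A $$ (i', j') \<noteq> 0 \<longrightarrow> i < i' \<longrightarrow> j \<le> j')"

text \<open>Only the identity contributes to the Leibniz expansion: a permutation with nonvanishing
  product has no inversions.\<close>

lemma minor_monotone_support:
  assumes A: "A \<in> carrier_mat r c" and supp: "monotone_support A"
    and I: "I \<subseteq> {..<r}" and J: "J \<subseteq> {..<c}" and m: "card I = m" "card J = m"
  shows "minor A I J = (\<Prod>k<m. A $$ (pick I k, pick J k))"
proof -
  let ?M = "mat m m (\<lambda>(i, j). A $$ (pick I i, pick J j))"
  let ?P = "{p. p permutes {0..<m}}"
  have zero: "(\<Prod>i = 0..<m. ?M $$ (i, p i)) = 0" if p: "p permutes {0..<m}" "p \<noteq> id" for p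
  proof (rule ccontr)
    assume nonzero: "(\<Prod>i = 0..<m. ?M $$ (i, p i)) \<noteq> 0"
    have nz: "?M $$ (i, p i) \<noteq> 0" if "i < m" for i
    proof
      assume "?M $$ (i, p i) = 0"
      then have "(\<Prod>i = 0..<m. ?M $$ (i, p i)) = 0"
        using that by (intro prod_zero bexI[of _ i]) simp_all
      with nonzero show False by contradiction
    qed
    have p_less: "p i < m" if "i < m" for i using permutes_in_image[OF p(1), of i] that by simp
    \<comment> \<open>The support condition makes \<open>p\<close> weakly increasing, and
      injectivity makes it strictly so.\<close>
    have mono: "p k < p l" if "k < l" "l < m" for k l
    proof -
      have "A $$ (pick I k, pick J (p k)) \<noteq> 0" "A $$ (pick I l, pick J (p l)) \<noteq> 0"
        using nz[of k] nz[of l] that p_less[of k] p_less[of l] by simp_all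
      moreover have "pick I k < dim_row A" "pick I l < dim_row A"
        "pick J (p k) < dim_col A" "pick J (p l) < dim_col A"
        using A m that p_less[of k] p_less[of l] pick_less[OF I] pick_less[OF J] by auto
      moreover have "pick I k < pick I l" using pick_mono_le[of l I k] that m by simp
      ultimately have "pick J (p k) \<le> pick J (p l)"
        using supp unfolding monotone_support_def by blast
      moreover have "p k \<noteq> p l" using permutes_inj[OF p(1)] that by (auto dest: injD)
      ultimately show ?thesis
        using pick_mono_le[of "p k" J "p l"] p_less[of k] that m by (force simp: not_le[symmetric])
    qed
    have "k < m \<Longrightarrow> k \<le> p k" for k
    proof (induction k)
      case (Suc k)
      then show ?case using mono[of k "Suc k"] by simp
    qed simp
    then have "p = id" by (intro permutes_natset_ge[OF p(1)]) auto
    with p(2) show False by simp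
  qed
  have "minor A I J = (\<Sum>p\<in>?P. signof p * (\<Prod>i = 0..<m. ?M $$ (i, p i)))"
    unfolding minor_eq_det_mat[OF A I J m] by (rule det_def') simp
  also have "\<dots> = (\<Sum>p\<in>{id}. signof p * (\<Prod>i = 0..<m. ?M $$ (i, p i)))"
    using zero by (intro sum.mono_neutral_right) (auto simp: finite_permutations permutes_id)
  finally show ?thesis by (simp add: atLeast0LessThan)
qed

section \<open>A criterion for oscillation matrices\<close>

text \<open>Strictly positive principal minors let an index set pass through a factor unchanged,
  which makes the class closed under products.\<close>

definition tn_principal :: "nat \<Rightarrow> real mat \<Rightarrow> bool" where
  "tn_principal n A \<longleftrightarrow> A \<in> carrier_mat n n \<and> totally_nonnegative A \<and>
     (\<forall>I \<subseteq> {..<n}. 0 < minor A I I)"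

text \<open>Meant for \<open>p \<in> I\<close> and \<open>Suc p \<notin> I\<close>, where a single
  index moves up by one place.\<close>

definition shift_up :: "nat \<Rightarrow> nat set \<Rightarrow> nat set" where
  "shift_up p I = insert (Suc p) (I - {p})"

definition raises :: "nat \<Rightarrow> real mat \<Rightarrow> bool" where
  "raises n A \<longleftrightarrow> (\<forall>I \<subseteq> {..<n}. \<forall>p \<in> I. Suc p \<notin> I \<longrightarrow> Suc p < n \<longrightarrow> 0 < minor A I (shift_up p I))"

definition lowers :: "nat \<Rightarrow> real mat \<Rightarrow> bool" where
  "lowers n A \<longleftrightarrow> (\<forall>I \<subseteq> {..<n}. \<forall>p \<in> I. Suc p \<notin> I \<longrightarrow> Suc p < n \<longrightarrow> 0 < minor A (shift_up p I) I)"

lemma card_shift_up: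
  assumes "finite I" "p \<in> I" "Suc p \<notin> I"
  shows "card (shift_up p I) = card I"
  using assms card_Suc_Diff1[of I p] unfolding shift_up_def by simp

lemma shift_up_subset: "I \<subseteq> {..<n} \<Longrightarrow> Suc p < n \<Longrightarrow> shift_up p I \<subseteq> {..<n}"
  unfolding shift_up_def by auto

text \<open>The moved index keeps its rank, since no integer lies strictly between \<open>p\<close>
  and \<open>Suc p\<close> and the latter is free.\<close>

lemma pick_shift_up:
  assumes "finite I" "p \<in> I" "Suc p \<notin> I" "k < card I"
  shows "pick (shift_up p I) k = (if pick I k = p then Suc p else pick I k)"
proof -
  define g where "g k = (if pick I k = p then Suc p else pick I k)" for k
  have "g ` {..<card I} = (\<lambda>i. if i = p then Suc p else i) ` pick I ` {..<card I}"
    unfolding g_def image_image ..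
  also have "\<dots> = shift_up p I"
    unfolding pick_image[OF assms(1)] shift_up_def using assms(2) by auto
  finally have img: "g ` {..<card I} = shift_up p I" .
  have "g k < g l" if "k < l" "l < card I" for k l
    using pick_mono_le[OF that(2,1)] pick_in_set_le[of l I] that assms(3)
    unfolding g_def by (auto intro!: Suc_lessI)
  from pick_strict_mono_image[of "card I" g, OF this assms(4)]
  show ?thesis unfolding img g_def .
qed

section \<open>Closure of the positivity classes under products\<close>

lemma totally_nonnegativeD:
  assumes "totally_nonnegative A" "A \<in> carrier_mat r c" "I \<subseteq> {..<r}" "J \<subseteq> {..<c}" "card I = card J"
  shows "0 \<le> minor A I J"
  using assms unfolding totally_nonnegative_def by auto

lemma totally_nonnegative_mult:
  assumes A: "A \<in> carrier_mat r n" "totally_nonnegative A"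
    and B: "B \<in> carrier_mat n c" "totally_nonnegative B"
  shows "totally_nonnegative (A * B)"
  unfolding totally_nonnegative_def
proof (intro allI impI)
  fix I J assume "I \<subseteq> {..<dim_row (A * B)}" "J \<subseteq> {..<dim_col (A * B)}" and c: "card I = card J"
  then have IJ: "I \<subseteq> {..<r}" "J \<subseteq> {..<c}" using A B by auto
  show "0 \<le> minor (A * B) I J"
    unfolding Cauchy_Binet[OF A(1) B(1) IJ c refl]
    using IJ c totally_nonnegativeD[OF A(2,1)] totally_nonnegativeD[OF B(2,1)]
    by (intro sum_nonneg mult_nonneg_nonneg) auto
qed

text \<open>All terms of the Cauchy-Binet sum are nonnegative, so the single positive term at
  \<open>K\<close> suffices.\<close>

lemma minor_mult_pos:
  assumes A: "A \<in> carrier_mat r n" "totally_nonnegative A"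
    and B: "B \<in> carrier_mat n c" "totally_nonnegative B"
    and IJ: "I \<subseteq> {..<r}" "J \<subseteq> {..<c}" "card I = card K" "card J = card K" and K: "K \<subseteq> {..<n}"
    and pos: "0 < minor A I K" "0 < minor B K J"
  shows "0 < minor (A * B) I J"
proof -
  let ?K = "{L. L \<subseteq> {..<n} \<and> card L = card K}"
  have "minor A I K * minor B K J \<le> (\<Sum>L\<in>?K. minor A I L * minor B L J)"
    using IJ K totally_nonnegativeD[OF A(2,1)] totally_nonnegativeD[OF B(2,1)]
    by (intro member_le_sum mult_nonneg_nonneg) auto
  then show ?thesis unfolding Cauchy_Binet[OF A(1) B(1) IJ] using mult_pos_pos[OF pos] by linarith
qed

lemma tn_principal_mult:
  assumes "tn_principal n A" "tn_principal n B"
  shows "tn_principal n (A * B)"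
  using assms totally_nonnegative_mult[of A n n B n]
  unfolding tn_principal_def by (auto intro!: minor_mult_pos[of A n n B n])

text \<open>The factor that raises performs the move while the other one keeps its index set; the
  intermediate set is \<open>shift_up p I\<close> or \<open>I\<close> accordingly.\<close>

lemma raises_mult:
  assumes "tn_principal n A" "tn_principal n B" "raises n A \<or> raises n B"
  shows "raises n (A * B)"
  unfolding raises_def
proof (intro allI ballI impI)
  fix I p assume I: "I \<subseteq> {..<n}" "p \<in> I" "Suc p \<notin> I" "Suc p < n"
  note c = card_shift_up[OF finite_subset[OF I(1) finite_lessThan] I(2,3)]
  note S = shift_up_subset[OF I(1,4)]
  have AB: "A \<in> carrier_mat n n" "totally_nonnegative A" "B \<in> carrier_mat n n" "totally_nonnegative B"
    "0 < minor A I I" "0 < minor B (shift_up p I) (shift_up p I)"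
    using assms(1,2) I S unfolding tn_principal_def by auto
  from assms(3) show "0 < minor (A * B) I (shift_up p I)"
  proof
    assume "raises n A"
    then have *: "0 < minor A I (shift_up p I)" using I unfolding raises_def by blast
    show ?thesis by (rule minor_mult_pos[OF AB(1-4) I(1) S c[symmetric] refl S * AB(6)])
  next
    assume "raises n B"
    then have *: "0 < minor B I (shift_up p I)" using I unfolding raises_def by blast
    show ?thesis by (rule minor_mult_pos[OF AB(1-4) I(1) S refl c I(1) AB(5) *])
  qed
qed

lemma lowers_mult:
  assumes "tn_principal n A" "tn_principal n B" "lowers n A \<or> lowers n B"
  shows "lowers n (A * B)"
  unfolding lowers_def
proof (intro allI ballI impI)
  fix I p assume I: "I \<subseteq> {..<n}" "p \<in> I" "Suc p \<notin> I" "Suc p < n"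
  note c = card_shift_up[OF finite_subset[OF I(1) finite_lessThan] I(2,3)]
  note S = shift_up_subset[OF I(1,4)]
  have AB: "A \<in> carrier_mat n n" "totally_nonnegative A" "B \<in> carrier_mat n n" "totally_nonnegative B"
    "0 < minor A (shift_up p I) (shift_up p I)" "0 < minor B I I"
    using assms(1,2) I S unfolding tn_principal_def by auto
  from assms(3) show "0 < minor (A * B) (shift_up p I) I"
  proof
    assume "lowers n A"
    then have *: "0 < minor A (shift_up p I) I" using I unfolding lowers_def by blast
    show ?thesis by (rule minor_mult_pos[OF AB(1-4) S I(1) c refl I(1) * AB(6)])
  next
    assume "lowers n B"
    then have *: "0 < minor B (shift_up p I) I" using I unfolding lowers_def by blast
    show ?thesis by (rule minor_mult_pos[OF AB(1-4) S I(1) refl c[symmetric] S AB(5) *])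
  qed
qed

section \<open>Positivity classes of matrices with monotone support\<close>

lemma tn_principal_monotone_support:
  assumes A: "A \<in> carrier_mat n n" "monotone_support A"
    and nonneg: "\<And>i j. i < n \<Longrightarrow> j < n \<Longrightarrow> 0 \<le> A $$ (i, j)"
    and diag: "\<And>i. i < n \<Longrightarrow> 0 < A $$ (i, i)"
  shows "tn_principal n A"
proof -
  have "0 \<le> minor A I J" if "I \<subseteq> {..<n}" "J \<subseteq> {..<n}" "card I = card J" for I J
    unfolding minor_monotone_support[OF A that refl]
    using that pick_less[of I n] pick_less[of J n] by (intro prod_nonneg) (auto intro!: nonneg)
  moreover have "0 < minor A I I" if "I \<subseteq> {..<n}" for I
    unfolding minor_monotone_support[OF A that that refl refl]
    using that pick_less[of I n] by (intro prod_pos) (auto intro!: diag)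
  ultimately show ?thesis using A unfolding tn_principal_def totally_nonnegative_def by auto
qed

text \<open>By \<open>pick_shift_up\<close> the minor is a product of diagonal entries and one
  superdiagonal entry, the one in row \<open>p\<close>.\<close>

lemma raises_monotone_support:
  assumes A: "A \<in> carrier_mat n n" "monotone_support A"
    and diag: "\<And>i. i < n \<Longrightarrow> 0 < A $$ (i, i)"
    and super: "\<And>i. Suc i < n \<Longrightarrow> 0 < A $$ (i, Suc i)"
  shows "raises n A"
  unfolding raises_def
proof (intro allI ballI impI)
  fix I p assume I: "I \<subseteq> {..<n}" "p \<in> I" "Suc p \<notin> I" "Suc p < n"
  note fin = finite_subset[OF I(1) finite_lessThan]
  show "0 < minor A I (shift_up p I)"
    unfolding minor_monotone_support[OF A I(1) shift_up_subset[OF I(1,4)] refl card_shift_up[OF fin I(2,3)]]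
    using I pick_less[of I n] by (intro prod_pos) (auto simp: pick_shift_up[OF fin I(2,3)] intro!: diag super)
qed

lemma lowers_monotone_support:
  assumes A: "A \<in> carrier_mat n n" "monotone_support A"
    and diag: "\<And>i. i < n \<Longrightarrow> 0 < A $$ (i, i)"
    and sub: "\<And>i. Suc i < n \<Longrightarrow> 0 < A $$ (Suc i, i)"
  shows "lowers n A"
  unfolding lowers_def
proof (intro allI ballI impI)
  fix I p assume I: "I \<subseteq> {..<n}" "p \<in> I" "Suc p \<notin> I" "Suc p < n"
  note fin = finite_subset[OF I(1) finite_lessThan]
  show "0 < minor A (shift_up p I) I"
    unfolding minor_monotone_support[OF A shift_up_subset[OF I(1,4)] I(1) card_shift_up[OF fin I(2,3)] refl]
    using I pick_less[of I n] by (intro prod_pos) (auto simp: pick_shift_up[OF fin I(2,3)] intro!: diag sub)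
qed

section \<open>Restriction to leading blocks\<close>

lemma minor_leading:
  assumes "A \<in> carrier_mat N N" "n \<le> N" "I \<subseteq> {..<n}" "J \<subseteq> {..<n}" "card I = card J"
  shows "minor (mat n n (\<lambda>(i, j). A $$ (i, j))) I J = minor A I J"
  by (rule minor_cong[of _ n n A N N]) (use assms in \<open>auto simp: subset_iff\<close>)

lemma leading_tn_principal:
  assumes "tn_principal N A" "n \<le> N"
  shows "tn_principal n (mat n n (\<lambda>(i, j). A $$ (i, j)))"
proof -
  have sub: "{..<n} \<subseteq> {..<N}" using assms by auto
  show ?thesis
    using assms(1) minor_leading[OF _ assms(2), of A] subset_trans[OF _ sub]
    unfolding tn_principal_def totally_nonnegative_def by auto
qed

lemma leading_raises_lowers:
  assumes "A \<in> carrier_mat N N" "n \<le> N"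
  shows "raises N A \<Longrightarrow> raises n (mat n n (\<lambda>(i, j). A $$ (i, j)))"
    and "lowers N A \<Longrightarrow> lowers n (mat n n (\<lambda>(i, j). A $$ (i, j)))"
proof -
  have *: "minor (mat n n (\<lambda>(i, j). A $$ (i, j))) I (shift_up p I) = minor A I (shift_up p I)"
    "minor (mat n n (\<lambda>(i, j). A $$ (i, j))) (shift_up p I) I = minor A (shift_up p I) I"
    "I \<subseteq> {..<N}" "Suc p < N"
    if "I \<subseteq> {..<n}" "p \<in> I" "Suc p \<notin> I" "Suc p < n" for I p
    using that minor_leading[OF assms, of I "shift_up p I"] minor_leading[OF assms, of "shift_up p I" I]
      shift_up_subset[of I n p] card_shift_up[of I p] finite_subset[OF that(1)] assms(2) by auto
  show "raises n (mat n n (\<lambda>(i, j). A $$ (i, j)))" if "raises N A"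
    using that * unfolding raises_def by simp
  show "lowers n (mat n n (\<lambda>(i, j). A $$ (i, j)))" if "lowers N A"
    using that * unfolding lowers_def by simp
qed

section \<open>Powers and chains of single-index moves\<close>

lemma tn_principal_power:
  assumes "tn_principal n A"
  shows "tn_principal n (A ^\<^sub>m k)"
proof (induction k)
  case 0
  have "dim_row A = n" using assms unfolding tn_principal_def by auto
  moreover have "tn_principal n (1\<^sub>m n)"
    by (rule tn_principal_monotone_support) (auto simp: monotone_support_def split: if_splits)
  ultimately show ?case by simp
qed (simp add: tn_principal_mult assms)

text \<open>The exponent may depend on the pair of index sets; \<open>oscillation_matrixI\<close>
  makes it uniform.\<close>

definition reaches :: "nat \<Rightarrow> real mat \<Rightarrow> nat set \<Rightarrow> nat set \<Rightarrow> bool" where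
  "reaches n A I J \<longleftrightarrow> (\<exists>k. 0 < minor (A ^\<^sub>m k) I J)"

lemma pow_mat_add:
  assumes "A \<in> carrier_mat n n"
  shows "A ^\<^sub>m (k + l) = A ^\<^sub>m k * A ^\<^sub>m l"
proof (induction l)
  case (Suc l)
  have "A ^\<^sub>m k * A ^\<^sub>m l * A = A ^\<^sub>m k * (A ^\<^sub>m l * A)"
    by (rule assoc_mult_mat[of _ n n _ n _ n]) (use assms in auto)
  then show ?case using Suc by simp
qed (use assms in auto)

lemma minor_power_add_pos:
  assumes A: "tn_principal n A" and sub: "I \<subseteq> {..<n}" "J \<subseteq> {..<n}" "K \<subseteq> {..<n}"
    and c: "card I = card K" "card J = card K"
    and pos: "0 < minor (A ^\<^sub>m k) I K" "0 < minor (A ^\<^sub>m l) K J"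
  shows "0 < minor (A ^\<^sub>m (k + l)) I J"
proof -
  note T = tn_principal_power[OF A, unfolded tn_principal_def]
  have "A ^\<^sub>m (k + l) = A ^\<^sub>m k * A ^\<^sub>m l"
    using A pow_mat_add[of A n k l] unfolding tn_principal_def by auto
  then show ?thesis
    using minor_mult_pos[of "A ^\<^sub>m k" n n "A ^\<^sub>m l" n I J K] T[of k] T[of l] sub c pos by simp
qed

text \<open>Every index set is connected to the initial segment of the same size by moves of a single
  index to a free neighbouring position.\<close>

lemma reaches_initial_segment:
  assumes A: "tn_principal n A" "raises n A" "lowers n A" and I: "I \<subseteq> {..<n}"
  shows "reaches n A I {..<card I} \<and> reaches n A {..<card I} I"
  using I
\<comment> \<open>Moving an index to its lower neighbour decreases the sum of the indices.\<close>
proof (induction "\<Sum>I" arbitrary: I rule: less_induct)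
  case less
  note fin = finite_subset[OF less.prems finite_lessThan]
  have cI: "card I \<le> n" using card_mono[OF _ less.prems] by simp
  show ?case
  proof (cases "\<exists>p. Suc p \<in> I \<and> p \<notin> I")
    case False
    \<comment> \<open>No member has a free position directly below it, so \<open>I\<close> is
      downward closed.\<close>
    have down: "q \<in> I" if "p \<in> I" "q \<le> p" for p q
      using that(2,1)
    proof (induction q rule: inc_induct)
      case (step q)
      then show ?case using False by blast
    qed
    have "I = {..<card I}"
    proof (rule card_subset_eq)
      show "I \<subseteq> {..<card I}"
      proof
        fix p assume "p \<in> I"
        then have "{..p} \<subseteq> I" using down by auto
        then show "p \<in> {..<card I}" using card_mono[OF fin, of "{..p}"] by simp
      qed
    qed simp_all
    moreover have "0 < minor (A ^\<^sub>m 0) I I"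
      using tn_principal_power[OF A(1), of 0] less.prems unfolding tn_principal_def by blast
    ultimately show ?thesis unfolding reaches_def by metis
  next
    case True
    then obtain p where p: "Suc p \<in> I" "p \<notin> I" by blast
    \<comment> \<open>\<open>I'\<close> is \<open>I\<close> with \<open>Suc p\<close> moved down to
      \<open>p\<close>; \<open>lowers\<close> provides the move from \<open>I\<close> to
      \<open>I'\<close> and \<open>raises\<close> the way back.\<close>
    define I' where "I' = insert p (I - {Suc p})"
    have I: "shift_up p I' = I" "p \<in> I'" "Suc p \<notin> I'" "Suc p < n" "I' \<subseteq> {..<n}"
      using p less.prems unfolding shift_up_def I'_def by auto
    have c: "card I' = card I" using card_shift_up[OF _ I(2,3)] I(1) fin unfolding I'_def by auto
    have "\<Sum>I' < \<Sum>I"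
      using p fin sum.remove[of I "Suc p" "\<lambda>x. x"] unfolding I'_def by simp
    from less.hyps[OF this I(5)] obtain k l where
      kl: "0 < minor (A ^\<^sub>m k) I' {..<card I}" "0 < minor (A ^\<^sub>m l) {..<card I} I'"
      unfolding reaches_def c by blast
    have dims: "A ^\<^sub>m 1 = A" using A(1) unfolding tn_principal_def by auto
    have "0 < minor A I' (shift_up p I')" using A(2) I(2-5) unfolding raises_def by blast
    then have up: "0 < minor (A ^\<^sub>m 1) I' I" unfolding dims I(1) .
    have "0 < minor A (shift_up p I') I'" using A(3) I(2-5) unfolding lowers_def by blast
    then have down: "0 < minor (A ^\<^sub>m 1) I I'" unfolding dims I(1) .
    have seg: "{..<card I} \<subseteq> {..<n}" using cI by auto
    have c': "card I = card I'" "card {..<card I} = card I'" using c by simp_all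
    have "0 < minor (A ^\<^sub>m (1 + k)) I {..<card I}"
      by (rule minor_power_add_pos[OF A(1) less.prems seg I(5) c' down kl(1)])
    moreover have "0 < minor (A ^\<^sub>m (l + 1)) {..<card I} I"
      by (rule minor_power_add_pos[OF A(1) seg less.prems I(5) c'(2,1) kl(2) up])
    ultimately show ?thesis unfolding reaches_def by blast
  qed
qed

text \<open>Index sets of equal size are joined through their common initial segment. A minor
  positive in one power remains positive in all higher powers, and there are only finitely many
  pairs.\<close>

lemma oscillation_matrixI:
  assumes A: "tn_principal n A" "raises n A" "lowers n A"
  shows "oscillation_matrix A"
proof -
  have dim: "A \<in> carrier_mat n n" using A(1) unfolding tn_principal_def by blast
  let ?S = "{(I, J). I \<subseteq> {..<n} \<and> J \<subseteq> {..<n} \<and> card I = card J}"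
  have fin: "finite ?S" by (rule finite_subset[of _ "Pow {..<n} \<times> Pow {..<n}"]) auto
  have "\<exists>k. 0 < minor (A ^\<^sub>m k) I J" if "(I, J) \<in> ?S" for I J
  proof -
    from that have IJ: "I \<subseteq> {..<n}" "J \<subseteq> {..<n}" "card I = card J" by auto
    then have "card J \<le> n" using card_mono[of "{..<n}" J] by simp
    then have K: "{..<card J} \<subseteq> {..<n}" by auto
    obtain k where k: "0 < minor (A ^\<^sub>m k) I {..<card J}"
      using reaches_initial_segment[OF A IJ(1)] unfolding reaches_def IJ(3) by blast
    obtain l where l: "0 < minor (A ^\<^sub>m l) {..<card J} J"
      using reaches_initial_segment[OF A IJ(2)] unfolding reaches_def by blast
    have "card I = card {..<card J}" "card J = card {..<card J}" using IJ(3) by simp_all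
    from minor_power_add_pos[OF A(1) IJ(1,2) K this k l] show ?thesis by blast
  qed
  then have "\<forall>x\<in>?S. \<exists>k. 0 < minor (A ^\<^sub>m k) (fst x) (snd x)" by auto
  then obtain e where e: "\<forall>x\<in>?S. 0 < minor (A ^\<^sub>m e x) (fst x) (snd x)" by (rule bchoice[THEN exE])
  \<comment> \<open>The sum dominates every single exponent, and \<open>Suc\<close> makes the result
    positive.\<close>
  define k where "k = Suc (sum e ?S)"
  have "0 < minor (A ^\<^sub>m k) I J" if IJ: "I \<subseteq> {..<n}" "J \<subseteq> {..<n}" "card I = card J" for I J
  proof -
    have S: "(I, J) \<in> ?S" using IJ by simp
    have "e (I, J) \<le> sum e ?S" by (rule member_le_sum[OF S]) (simp_all add: fin)
    then have k: "k = (k - e (I, J)) + e (I, J)" unfolding k_def by simp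
    \<comment> \<open>The surplus factors leave \<open>I\<close> in place, by their positive
      principal minor.\<close>
    have p1: "0 < minor (A ^\<^sub>m (k - e (I, J))) I I"
      using tn_principal_power[OF A(1)] IJ(1) unfolding tn_principal_def by blast
    have p2: "0 < minor (A ^\<^sub>m e (I, J)) I J" using bspec[OF e S] unfolding fst_conv snd_conv .
    show ?thesis
      by (subst k, rule minor_power_add_pos[OF A(1) IJ(1,2,1) refl IJ(3)[symmetric] p1 p2])
  qed
  then have "totally_positive (A ^\<^sub>m k)"
    using pow_carrier_mat[OF dim, of k] unfolding totally_positive_def by (metis carrier_matD)
  moreover have "1 \<le> k" unfolding k_def by simp
  ultimately show ?thesis
    using dim A(1) unfolding oscillation_matrix_def tn_principal_def by auto
qed

section \<open>Zeros of the components\<close>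

text \<open>The determinant of \<open>u\<close> and \<open>v\<close> as vectors of the real plane,
  hence an alternating real bilinear form.\<close>

definition skew :: "complex \<Rightarrow> complex \<Rightarrow> real" where
  "skew u v = Im (v * cnj u)"

text \<open>Antisymmetry turns the negative coefficient of the recurrence into a positive
  contribution.\<close>

lemma skew_diff_scaled: "skew u (v - of_real r * w) = skew u v + r * skew w u"
  by (simp add: skew_def algebra_simps)

lemma skew_self: "skew u u = 0"
  by (simp add: skew_def)

text \<open>Taking \<open>M\<close> to be multiplication by a point \<open>z\<close> of the upper half-plane, the invariant says that
  the quotients of nearby polynomials map the half-plane into itself; the extra inequalities with
  \<open>M\<close> on one side are what makes it survive the steps in which the degree grows.\<close>

lemma skew_recurrence_interlacing:
  fixes v :: "nat \<Rightarrow> complex" and M :: "complex \<Rightarrow> complex"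
  assumes \<rho>: "\<And>n. 0 < \<rho> (n + 1)"
    and M_diff: "\<And>x y r. M (x - of_real r * y) = M x - of_real r * M y"
    and M_scale: "\<And>x y. skew (M x) (M y) = \<delta> * skew x y" and \<delta>: "0 \<le> \<delta>"
    and M_nonneg: "\<And>x. 0 \<le> skew x (M x)"
    and init: "\<And>n. n \<le> d \<Longrightarrow> v n = v0" and init_pos: "0 < skew v0 (M v0)"
    and rec: "\<And>n. v (n + d + 1) =
      (if n mod (d + 1) = 0 then M (v (n + d)) else v (n + d)) - of_real (\<rho> (n + 1)) * v n"
    and jk: "j < k" "k \<le> j + d"
  shows "if j div (d + 1) = k div (d + 1)
    then 0 \<le> skew (v j) (v k) \<and> 0 < skew (v j) (M (v k)) \<and>
      (skew (v j) (v k) = 0 \<longrightarrow> 0 < skew (v k) (M (v k)))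
    else 0 < skew (v j) (v k) \<and> 0 < skew (M (v j)) (v k)"
  using jk
proof (induction k arbitrary: j rule: less_induct)
  case (less k)
  show ?case
  proof (cases "k \<le> d")
    case True
    then have "j div (d + 1) = k div (d + 1)" "v j = v0" "v k = v0"
      using less.prems init by auto
    \<comment> \<open>The form vanishes on equal initial vectors, so the clause for a vanishing form
      is needed; \<open>init_pos\<close> supplies it.\<close>
    then show ?thesis using init_pos by (simp add: skew_self)
  next
    case False
    define n where "n = k - (d + 1)"
    define p where "p = n + d"
    define q where "q = n div (d + 1)"
    have k: "k = n + d + 1" using False unfolding n_def by simp
    have j: "n < j" "j \<le> p" using less.prems unfolding k p_def by auto
    have k_div: "k div (d + 1) = q + 1"
      unfolding k q_def using div_add_self2[of "d + 1" n] by (simp only: add.assoc)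
    \<comment> \<open>As \<open>v k\<close> is made from \<open>v p\<close> and \<open>v n\<close>,
      the invariant is used on both sides of \<open>j\<close>: for \<open>n\<close>,
      \<open>j\<close> and, unless \<open>j = p\<close>, for \<open>j\<close>,
      \<open>p\<close>.\<close>
    have nj: "if n div (d + 1) = j div (d + 1)
      then 0 \<le> skew (v n) (v j) \<and> 0 < skew (v n) (M (v j)) \<and>
        (skew (v n) (v j) = 0 \<longrightarrow> 0 < skew (v j) (M (v j)))
      else 0 < skew (v n) (v j) \<and> 0 < skew (M (v n)) (v j)"
      by (rule less.IH) (use j k p_def in auto)
    have jp: "if j div (d + 1) = p div (d + 1)
      then 0 \<le> skew (v j) (v p) \<and> 0 < skew (v j) (M (v p)) \<and>
        (skew (v j) (v p) = 0 \<longrightarrow> 0 < skew (v p) (M (v p)))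
      else 0 < skew (v j) (v p) \<and> 0 < skew (M (v j)) (v p)" if "j < p"
      by (rule less.IH) (use j k p_def that in auto)
    have \<rho>n: "0 < \<rho> (n + 1)" by (rule \<rho>)
    have n_eq: "n = (d + 1) * q + n mod (d + 1)" unfolding q_def by (simp only: mult_div_mod_eq)
    have jd: "q \<le> j div (d + 1)" "j div (d + 1) \<le> p div (d + 1)"
      unfolding q_def using j by (auto intro: div_le_mono)
    show ?thesis
    proof (cases "n mod (d + 1) = 0")
      case True
      \<comment> \<open>Here \<open>n\<close>, \<open>j\<close> and \<open>p\<close> share block
        \<open>q\<close>, while \<open>k\<close> opens block \<open>q + 1\<close>.\<close>
      have "p = d + q * (d + 1)" using n_eq True unfolding p_def by simp
      then have p_div: "p div (d + 1) = q" using div_block[of d "d + 1" q] by (simp only:)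
      then have j_div: "j div (d + 1) = q" using jd by simp
      have vk: "v k = M (v p) - of_real (\<rho> (n + 1)) * v n" unfolding k p_def rec using True by simp
      have a: "0 \<le> skew (v n) (v j)" "0 < skew (v n) (M (v j))"
        "skew (v n) (v j) = 0 \<Longrightarrow> 0 < skew (v j) (M (v j))"
        using nj unfolding j_div q_def by auto
      have b: "0 \<le> skew (v j) (v p)" "j < p \<Longrightarrow> 0 < skew (v j) (M (v p))"
        using jp j unfolding j_div p_div by (cases "j = p"; auto simp: skew_self)+
      \<comment> \<open>For \<open>j < p\<close> the first summand is positive. For
        \<open>j = p\<close> the second one is, or else it vanishes and the last clause of the
        invariant for \<open>n\<close>, \<open>j\<close> makes the first one positive.\<close>
      have "0 < skew (v j) (M (v p)) + \<rho> (n + 1) * skew (v n) (v j)"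
      proof (cases "j = p \<and> skew (v n) (v j) \<noteq> 0")
        case True
        then have "0 < \<rho> (n + 1) * skew (v n) (v j)"
          using a(1) \<rho>n by (intro mult_pos_pos) auto
        moreover have "0 \<le> skew (v j) (M (v p))" using True M_nonneg by simp
        ultimately show ?thesis by linarith
      next
        case False
        then have "0 < skew (v j) (M (v p))" using a(3) b(2) j(2) by (cases "j = p") auto
        then show ?thesis using a(1) \<rho>n by (simp add: add_pos_nonneg)
      qed
      moreover have "0 < \<delta> * skew (v j) (v p) + \<rho> (n + 1) * skew (v n) (M (v j))"
        using a(2) b(1) \<rho>n \<delta> by (intro add_nonneg_pos) auto
      ultimately show ?thesis
        unfolding j_div k_div vk skew_diff_scaled M_scale by simp
    next
      case False
      \<comment> \<open>Now \<open>p\<close> lies in block \<open>q + 1\<close> together with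
        \<open>k\<close>, and \<open>j\<close> may lie in block \<open>q\<close> or
        \<open>q + 1\<close>.\<close>
      have lt: "n mod (d + 1) - 1 < d + 1" using mod_less_divisor[of "d + 1" n] by linarith
      have "p = (n mod (d + 1) - 1) + (q + 1) * (d + 1)"
        using n_eq False unfolding p_def by (simp add: algebra_simps)
      then have p_div: "p div (d + 1) = q + 1" using div_block[OF lt, of "q + 1"] by (simp only:)
      have vk: "v k = v p - of_real (\<rho> (n + 1)) * v n" unfolding k p_def rec using False by simp
      consider (new) "j div (d + 1) = q + 1" | (old) "j div (d + 1) = q"
        using jd p_div by linarith
      then show ?thesis
      proof cases
        case new
        have a: "0 < skew (v n) (v j)" "0 < skew (M (v n)) (v j)"
          using nj unfolding new q_def by auto
        have b: "0 \<le> skew (v j) (v p)" "0 \<le> skew (v j) (M (v p))"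
          using jp j M_nonneg[of "v p"] unfolding new p_div by (cases "j = p"; auto simp: skew_self)+
        have "0 < skew (v j) (v p) + \<rho> (n + 1) * skew (v n) (v j)"
          "0 < skew (v j) (M (v p)) + \<rho> (n + 1) * skew (M (v n)) (v j)"
          using a b \<rho>n by (simp_all add: add_nonneg_pos)
        then show ?thesis unfolding new k_div vk M_diff skew_diff_scaled by simp
      next
        case old
        then have "j < p" using j p_div by (cases "j = p") auto
        then have b: "0 < skew (v j) (v p)" "0 < skew (M (v j)) (v p)"
          using jp unfolding old p_div by auto
        have a: "0 \<le> skew (v n) (v j)" "0 < skew (v n) (M (v j))"
          using nj unfolding old q_def by auto
        have "0 < skew (v j) (v p) + \<rho> (n + 1) * skew (v n) (v j)"
          "0 < skew (M (v j)) (v p) + \<rho> (n + 1) * skew (v n) (M (v j))"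
          using a b \<rho>n by (simp_all add: add_pos_nonneg)
        then show ?thesis unfolding old k_div vk skew_diff_scaled by simp
      qed
    qed
  qed
qed

text \<open>If \<open>v k\<close> were 0, the form would vanish against \<open>v k\<close> and
  \<open>M (v k)\<close>, but comparison with the preceding vector makes one of these values
  positive.\<close>

lemma skew_recurrence_nonzero:
  fixes v :: "nat \<Rightarrow> complex" and M :: "complex \<Rightarrow> complex"
  assumes d: "1 \<le> d" and \<rho>: "\<And>n. 0 < \<rho> (n + 1)"
    and M_diff: "\<And>x y r. M (x - of_real r * y) = M x - of_real r * M y"
    and M_scale: "\<And>x y. skew (M x) (M y) = \<delta> * skew x y" and \<delta>: "0 \<le> \<delta>"
    and M_nonneg: "\<And>x. 0 \<le> skew x (M x)"
    and init: "\<And>n. n \<le> d \<Longrightarrow> v n = v0" and init_pos: "0 < skew v0 (M v0)"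
    and rec: "\<And>n. v (n + d + 1) =
      (if n mod (d + 1) = 0 then M (v (n + d)) else v (n + d)) - of_real (\<rho> (n + 1)) * v n"
  shows "v k \<noteq> 0"
proof
  assume k: "v k = 0"
  have "M 0 = 0" using M_diff[of 0 1 0] M_diff[of 0 0 1] by simp
  then have zero: "skew u 0 = 0" "skew u (M 0) = 0" for u by (simp_all add: skew_def)
  have "0 < k" using k init[of 0] init_pos zero(2)[of 0] by (cases k) auto
  then have "k - 1 < k" "k \<le> k - 1 + d" using d by auto
  from skew_recurrence_interlacing[OF \<rho> M_diff M_scale \<delta> M_nonneg init init_pos rec this]
  show False unfolding k zero by (simp split: if_splits)
qed

section \<open>Zeros of polynomials obeying the quotient recurrence\<close>

interpretation cpoly: map_poly_comm_ring_hom complex_of_real ..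

text \<open>\<open>Q m\<close> models \<open>B m\<close> with its factor
  \<open>monom 1 (m mod (d + 1))\<close> removed and the remaining power \<open>x^(d+1)\<close>
  taken as the variable; that variable appears as a factor when the residue wraps around.\<close>

locale quotient_recurrence =
  fixes d :: nat and \<rho> :: "nat \<Rightarrow> real" and Q :: "nat \<Rightarrow> real poly"
  assumes d: "1 \<le> d" and \<rho>: "\<And>n. 0 < \<rho> (n + 1)"
    and init: "\<And>n. n \<le> d \<Longrightarrow> Q n = 1"
    and rec: "\<And>n. Q (n + d + 1) =
      (if n mod (d + 1) = 0 then [:0, 1:] * Q (n + d) else Q (n + d)) - smult (\<rho> (n + 1)) (Q n)"
begin

text \<open>Multiplication by \<open>z\<close> scales the form by the squared modulus, and for
  \<open>Im z > 0\<close> it turns every nonzero vector in the positive sense.\<close>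

lemma no_upper_root:
  assumes z: "0 < Im z"
  shows "poly (map_poly complex_of_real (Q k)) z \<noteq> 0"
proof (rule skew_recurrence_nonzero[where d = d and \<rho> = \<rho> and
      M = "\<lambda>w. z * w" and \<delta> = "(cmod z)\<^sup>2" and ?v0.0 = 1 and
      v = "\<lambda>k. poly (map_poly complex_of_real (Q k)) z"])
  fix x y :: complex and r :: real
  show "z * (x - of_real r * y) = z * x - of_real r * (z * y)" by (simp add: algebra_simps)
  show "skew (z * x) (z * y) = (cmod z)\<^sup>2 * skew x y"
    unfolding skew_def cmod_power2 by (simp add: algebra_simps power2_eq_square)
  have "skew x (z * x) = Im z * (cmod x)\<^sup>2"
    unfolding skew_def cmod_power2 by (simp add: algebra_simps power2_eq_square)
  then show "0 \<le> skew x (z * x)" using z by simp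
  show "0 < skew 1 (z * 1)" using z by (simp add: skew_def)
next
  fix n
  show "poly (map_poly complex_of_real (Q (n + d + 1))) z =
     (if n mod (d + 1) = 0 then z * poly (map_poly complex_of_real (Q (n + d))) z
      else poly (map_poly complex_of_real (Q (n + d))) z) -
     of_real (\<rho> (n + 1)) * poly (map_poly complex_of_real (Q n)) z"
    unfolding rec by (simp add: cpoly.hom_minus of_real_hom.map_poly_hom_smult of_real_hom.map_poly_pCons_hom)
qed (use d \<rho> in \<open>auto simp: init\<close>)

text \<open>The values of a polynomial and of its derivative at a real point are packed into one complex
  number; multiplication by the variable becomes the map below, and \<open>skew\<close> the Wronskian.\<close>

lemma no_double_root: "poly (Q k) t \<noteq> 0 \<or> poly (pderiv (Q k)) t \<noteq> 0"
proof -
  have "Complex (poly (Q k) t) (poly (pderiv (Q k)) t) \<noteq> 0"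
  proof (rule skew_recurrence_nonzero[where d = d and \<rho> = \<rho> and
        M = "\<lambda>w. Complex (t * Re w) (Re w + t * Im w)" and \<delta> = "t\<^sup>2" and ?v0.0 = 1 and
        v = "\<lambda>k. Complex (poly (Q k) t) (poly (pderiv (Q k)) t)"])
    fix x y :: complex and r :: real
    let ?M = "\<lambda>w. Complex (t * Re w) (Re w + t * Im w)"
    show "?M (x - of_real r * y) = ?M x - of_real r * ?M y"
      by (simp add: complex_eq_iff algebra_simps)
    \<comment> \<open>At \<open>t = 0\<close> the map is singular, which is why the scaling factor
      is only required to be nonnegative.\<close>
    show "skew (?M x) (?M y) = t\<^sup>2 * skew x y"
      by (simp add: skew_def algebra_simps power2_eq_square)
    \<comment> \<open>The cross terms cancel and leave the square of \<open>Re x\<close>.\<close>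
    show "0 \<le> skew x (?M x)" by (simp add: skew_def algebra_simps)
    show "0 < skew 1 (?M 1)" by (simp add: skew_def)
  next
    fix n
    show "Complex (poly (Q (n + d + 1)) t) (poly (pderiv (Q (n + d + 1))) t) =
      (if n mod (d + 1) = 0 then
         Complex (t * Re (Complex (poly (Q (n + d)) t) (poly (pderiv (Q (n + d))) t)))
           (Re (Complex (poly (Q (n + d)) t) (poly (pderiv (Q (n + d))) t)) +
            t * Im (Complex (poly (Q (n + d)) t) (poly (pderiv (Q (n + d))) t)))
       else Complex (poly (Q (n + d)) t) (poly (pderiv (Q (n + d))) t)) -
      of_real (\<rho> (n + 1)) * Complex (poly (Q n) t) (poly (pderiv (Q n)) t)"
      unfolding rec
      by (simp add: complex_eq_iff pderiv_diff pderiv_smult pderiv_mult pderiv_pCons)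
  qed (use d \<rho> in \<open>auto simp: init complex_eq_iff\<close>)
  then show ?thesis by (auto simp: complex_eq_iff)
qed

text \<open>Both terms of the recurrence contribute with the sign of block \<open>q + 1\<close>: the
  subtracted one comes from block \<open>q\<close>, the other lies in block \<open>q + 1\<close> or
  comes from block \<open>q\<close> with the factor \<open>t \<le> 0\<close>.\<close>

lemma sign_nonpositive:
  assumes t: "t \<le> 0"
  shows "0 < (-1) ^ (k div (d + 1)) * poly (Q k) t"
proof (induction k rule: less_induct)
  case (less k)
  show ?case
  proof (cases "k \<le> d")
    case True
    then show ?thesis by (simp add: init)
  next
    case False
    define n q where "n = k - (d + 1)" and "q = n div (d + 1)"
    have k: "k = n + d + 1" using False unfolding n_def by simp
    have k_div: "k div (d + 1) = q + 1"
      unfolding k q_def using div_add_self2[of "d + 1" n] by (simp only: add.assoc)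
    have n_eq: "n = (d + 1) * q + n mod (d + 1)" unfolding q_def by (simp only: mult_div_mod_eq)
    have n: "0 < \<rho> (n + 1) * ((-1) ^ q * poly (Q n) t)"
      using less.IH[of n] \<rho>[of n] k unfolding q_def by simp
    have p: "0 < (-1) ^ ((n + d) div (d + 1)) * poly (Q (n + d)) t"
      by (rule less.IH) (simp add: k)
    show ?thesis
    proof (cases "n mod (d + 1) = 0")
      case True
      have "n + d = d + q * (d + 1)" using n_eq True by simp
      then have "(n + d) div (d + 1) = q" using div_block[of d "d + 1" q] by (simp only:)
      then have "0 < (-1) ^ q * poly (Q (n + d)) t" using p by (simp only:)
      \<comment> \<open>Only a weak inequality, as \<open>t\<close> may be 0; strictness comes from
        the \<open>\<rho>\<close> term.\<close>
      then have "0 \<le> (- t) * ((-1) ^ q * poly (Q (n + d)) t)"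
        using t by (simp add: mult_nonpos_nonneg)
      then show ?thesis
        using n True unfolding k_div unfolding k rec by (simp add: algebra_simps)
    next
      case False
      have lt: "n mod (d + 1) - 1 < d + 1" using mod_less_divisor[of "d + 1" n] by linarith
      have "n + d = (n mod (d + 1) - 1) + (q + 1) * (d + 1)"
        using n_eq False by (simp add: algebra_simps)
      then have "(n + d) div (d + 1) = q + 1" using div_block[OF lt, of "q + 1"] by (simp only:)
      then show ?thesis
        using n p False unfolding k_div unfolding k rec by (simp add: algebra_simps)
    qed
  qed
qed

text \<open>Conjugation preserves the zeros of a real polynomial, so a nonreal zero would yield one
  in the upper half-plane; the sign lemma excludes the nonpositive axis.\<close>

lemma root_positive:
  assumes "poly (map_poly complex_of_real (Q k)) z = 0"
  shows "\<exists>r>0. z = complex_of_real r"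
proof -
  have "poly (map_poly complex_of_real (Q k)) (cnj z) = 0"
    using assms poly_cnj[of "map_poly complex_of_real (Q k)" z]
    by (simp add: map_poly_map_poly comp_def)
  then have "Im z = 0" using assms no_upper_root[of z k] no_upper_root[of "cnj z" k] by force
  then have z: "z = complex_of_real (Re z)" by (simp add: complex_eq_iff)
  then have "poly (Q k) (Re z) = 0"
    using assms of_real_hom.poly_map_poly[of "Q k" "Re z", where 'a = complex] by simp
  then have "0 < Re z" using sign_nonpositive[of "Re z" k] by (cases "Re z \<le> 0") auto
  with z show ?thesis by blast
qed

lemma rsquarefree: "rsquarefree (map_poly complex_of_real (Q k))"
  unfolding rsquarefree_roots
proof (intro allI notI, elim conjE)
  fix z assume z: "poly (map_poly complex_of_real (Q k)) z = 0"
    "poly (pderiv (map_poly complex_of_real (Q k))) z = 0"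
  obtain r where r: "z = complex_of_real r" using root_positive[OF z(1)] by blast
  show False using no_double_root[of k r] z unfolding r of_real_hom.map_poly_pderiv[symmetric] by simp
qed

end

section \<open>Characteristic polynomials of leading blocks\<close>

text \<open>Padding with the zeros right of the superdiagonal gives all rows \<open>k < n\<close>
  one common range of summation.\<close>

lemma monic_hessenberg_eq_leading:
  assumes P: "monic_poly_seq P" and "k < n"
  shows "[:0, 1:] * P k = (\<Sum>l\<le>n. smult (monic_hessenberg P k l) (P l))"
proof -
  have J: "is_monic_hessenberg P (monic_hessenberg P)"
    unfolding monic_hessenberg_def by (rule theI'[OF monic_hessenberg_ex1[OF P]])
  have "(\<Sum>l\<le>n. smult (monic_hessenberg P k l) (P l)) =
      (\<Sum>l\<le>k + 1. smult (monic_hessenberg P k l) (P l))"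
    using J \<open>k < n\<close> unfolding is_monic_hessenberg_def by (intro sum.mono_neutral_right) auto
  also have "\<dots> = [:0, 1:] * P k" using J unfolding is_monic_hessenberg_def by metis
  finally show ?thesis ..
qed

lemma monic_hessenberg_unique:
  assumes P: "monic_poly_seq P" and "k < n" "l \<le> n"
    and eq: "[:0, 1:] * P k = (\<Sum>l\<le>n. smult (c l) (P l))"
  shows "monic_hessenberg P k l = c l"
proof -
  have "(\<Sum>l\<le>n. smult (monic_hessenberg P k l - c l) (P l)) = 0"
    using monic_hessenberg_eq_leading[OF P \<open>k < n\<close>] unfolding eq
    by (simp add: smult_diff_left sum_subtractf)
  from monic_poly_seq_independent[OF P this \<open>l \<le> n\<close>] show ?thesis by simp
qed

lemma rsquarefree_card_roots:
  assumes "rsquarefree (p :: complex poly)"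
  shows "card {z. poly p z = 0} = degree p"
proof -
  have p: "p \<noteq> 0" using assms unfolding rsquarefree_def by simp
  have "degree p = degree (\<Prod>z | poly p z = 0. [:- z, 1:])"
    using p by (subst complex_poly_decompose_rsquarefree[OF assms, symmetric]) simp
  also have "\<dots> = card {z. poly p z = 0}"
    by (subst degree_prod_eq_sum_degree) auto
  finally show ?thesis ..
qed

text \<open>At a zero \<open>z\<close> of \<open>P n\<close> the values of \<open>P 0\<close>, ...,
  \<open>P (n - 1)\<close> form an eigenvector for \<open>z\<close>. The \<open>n\<close> distinct
  zeros and the common leading coefficient then determine the polynomial.\<close>

lemma char_poly_leading_principal:
  assumes P: "monic_poly_seq P" and n: "1 \<le> n"
    and sf: "rsquarefree (map_poly complex_of_real (P n))"
  shows "char_poly (map_mat complex_of_real (leading_principal n (monic_hessenberg P))) =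
    map_poly complex_of_real (P n)"
proof -
  let ?J = "monic_hessenberg P"
  let ?A = "map_mat complex_of_real (leading_principal n ?J)"
  let ?p = "\<lambda>k. map_poly complex_of_real (P k)"
  have A: "?A \<in> carrier_mat n n" unfolding leading_principal_def by simp
  have deg: "degree (?p k) = k" "lead_coeff (?p k) = 1" for k
    using P unfolding monic_poly_seq_def by simp (metis P monic_poly_seq_def of_real_1
      of_real_hom.coeff_map_poly_hom of_real_hom.degree_map_poly_hom)
  have P0: "P 0 = 1"
    using P monic_poly_seq_def[of P] by (metis degree_eq_zeroE lead_coeff_pCons(2) one_pCons)
  show ?thesis
  proof (rule poly_eqI_degree_lead_coeff[where n = n and A = "{z. poly (?p n) z = 0}"])
    show "coeff (char_poly ?A) n = coeff (?p n) n" "degree (char_poly ?A) \<le> n" "degree (?p n) \<le> n"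
      using degree_monic_char_poly[OF A] deg[of n] by simp_all
    show "n \<le> card {z. poly (?p n) z = 0}" unfolding rsquarefree_card_roots[OF sf] deg ..
    fix z assume "z \<in> {z. poly (?p n) z = 0}"
    then have z: "poly (?p n) z = 0" by simp
    define v where "v = vec n (\<lambda>k. poly (?p k) z)"
    have "?A *\<^sub>v v = z \<cdot>\<^sub>v v"
    proof (rule eq_vecI)
      fix k assume "k < dim_vec (z \<cdot>\<^sub>v v)"
      then have k: "k < n" unfolding v_def by simp
      have "z * poly (?p k) z = poly (map_poly complex_of_real ([:0, 1:] * P k)) z"
        by (simp add: of_real_hom.map_poly_pCons_hom)
      also have "\<dots> = (\<Sum>l\<le>n. of_real (?J k l) * poly (?p l) z)"
        unfolding monic_hessenberg_eq_leading[OF P k]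
        by (simp add: cpoly.hom_sum of_real_hom.map_poly_hom_smult poly_sum)
      \<comment> \<open>The summand \<open>l = n\<close>, which the block omits, vanishes because
        \<open>z\<close> is a zero of \<open>P n\<close>.\<close>
      also have "\<dots> = (\<Sum>l<n. of_real (?J k l) * poly (?p l) z)"
        unfolding lessThan_Suc_atMost[symmetric] by (simp add: z)
      finally show "(?A *\<^sub>v v) $ k = (z \<cdot>\<^sub>v v) $ k"
        using k unfolding v_def leading_principal_def by (simp add: scalar_prod_def atLeast0LessThan)
    qed (simp add: v_def leading_principal_def)
    moreover have "v \<noteq> 0\<^sub>v n"
    proof
      assume "v = 0\<^sub>v n"
      then have "v $ 0 = 0" using n by simp
      then show False using n unfolding v_def by (simp add: P0)
    qed
    ultimately have "eigenvector ?A v z"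
      unfolding eigenvector_def by (simp add: v_def leading_principal_def)
    then have "eigenvalue ?A z" unfolding eigenvalue_def by blast
    then show "poly (char_poly ?A) z = poly (?p n) z"
      unfolding eigenvalue_root_char_poly[OF A] z .
  qed
qed

lemma eigenvalues_positive_simple_leading:
  assumes P: "monic_poly_seq P" and n: "1 \<le> n"
    and sf: "rsquarefree (map_poly complex_of_real (P n))"
    and pos: "\<And>z. poly (map_poly complex_of_real (P n)) z = 0 \<Longrightarrow> \<exists>r>0. z = complex_of_real r"
  shows "eigenvalues_positive_simple (leading_principal n (monic_hessenberg P))"
proof -
  have A: "map_mat complex_of_real (leading_principal n (monic_hessenberg P)) \<in> carrier_mat n n"
    unfolding leading_principal_def by simp
  show ?thesis
    unfolding eigenvalues_positive_simple_def eigenvalue_root_char_poly[OF A]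
      char_poly_leading_principal[OF P n sf]
    using pos rsquarefree_root_order[OF sf] sf unfolding rsquarefree_def by blast
qed

section \<open>Bidiagonal factorization\<close>

definition mat_app :: "real mat \<Rightarrow> (nat \<Rightarrow> real poly) \<Rightarrow> nat \<Rightarrow> real poly" where
  "mat_app A f m = (\<Sum>k<dim_col A. smult (A $$ (m, k)) (f k))"

lemma mat_app_mult:
  assumes A: "A \<in> carrier_mat N N" and B: "B \<in> carrier_mat N N" and m: "m < N"
  shows "mat_app (A * B) f m = mat_app A (mat_app B f) m"
proof -
  have "mat_app (A * B) f m = (\<Sum>k<N. \<Sum>l<N. smult (A $$ (m, l) * B $$ (l, k)) (f k))"
    using A B m unfolding mat_app_def
    by (auto simp: scalar_prod_def atLeast0LessThan smult_sum intro!: sum.cong)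
  also have "\<dots> = (\<Sum>l<N. \<Sum>k<N. smult (A $$ (m, l) * B $$ (l, k)) (f k))"
    by (rule sum.swap)
  also have "\<dots> = mat_app A (mat_app B f) m"
    using A B unfolding mat_app_def by (simp add: smult_sum2)
  finally show ?thesis .
qed

lemma mat_app_cong:
  assumes "\<And>k. k < dim_col A \<Longrightarrow> f k = g k"
  shows "mat_app A f m = mat_app A g m"
  unfolding mat_app_def using assms by (intro sum.cong) auto

definition lower_bidiagonal :: "nat \<Rightarrow> (nat \<Rightarrow> real) \<Rightarrow> real mat" where
  "lower_bidiagonal N a = mat N N (\<lambda>(i, j). if i = j then 1 else if i = Suc j then a j else 0)"

definition upper_bidiagonal :: "nat \<Rightarrow> (nat \<Rightarrow> real) \<Rightarrow> real mat" where
  "upper_bidiagonal N a = mat N N (\<lambda>(i, j). if i = j then a i else if j = Suc i then 1 else 0)"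

lemma bidiagonal_carrier [simp]:
  "lower_bidiagonal N a \<in> carrier_mat N N" "upper_bidiagonal N a \<in> carrier_mat N N"
  unfolding lower_bidiagonal_def upper_bidiagonal_def by simp_all

lemma monotone_support_bidiagonal:
  "monotone_support (lower_bidiagonal N a)" "monotone_support (upper_bidiagonal N a)"
  unfolding monotone_support_def lower_bidiagonal_def upper_bidiagonal_def
  by (auto split: if_splits)

lemma lower_bidiagonal_tn:
  assumes "\<And>j. 0 < a j"
  shows "tn_principal N (lower_bidiagonal N a)" "lowers N (lower_bidiagonal N a)"
  using assms
  by (auto intro!: tn_principal_monotone_support lowers_monotone_support monotone_support_bidiagonal)
    (auto simp: lower_bidiagonal_def less_imp_le)

lemma upper_bidiagonal_tn:
  assumes "\<And>j. 0 < a j"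
  shows "tn_principal N (upper_bidiagonal N a)" "raises N (upper_bidiagonal N a)"
  using assms
  by (auto intro!: tn_principal_monotone_support raises_monotone_support monotone_support_bidiagonal)
    (auto simp: upper_bidiagonal_def less_imp_le)

lemma mat_app_lower_bidiagonal:
  assumes "m < N"
  shows "mat_app (lower_bidiagonal N a) f m = f m + (case m of 0 \<Rightarrow> 0 | Suc k \<Rightarrow> smult (a k) (f k))"
proof -
  have "mat_app (lower_bidiagonal N a) f m =
      (\<Sum>k<N. (if k = m then f m else 0) + (if m = Suc k then smult (a k) (f k) else 0))"
    using assms unfolding mat_app_def lower_bidiagonal_def by (auto intro!: sum.cong)
  also have "\<dots> = f m + (\<Sum>k<N. if m = Suc k then smult (a k) (f k) else 0)"
    using assms by (simp add: sum.distrib)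
  also have "(\<Sum>k<N. if m = Suc k then smult (a k) (f k) else 0) =
      (case m of 0 \<Rightarrow> 0 | Suc k \<Rightarrow> smult (a k) (f k))"
    using assms by (cases m) auto
  finally show ?thesis .
qed

lemma mat_app_upper_bidiagonal:
  assumes "Suc m < N"
  shows "mat_app (upper_bidiagonal N a) f m = f (Suc m) + smult (a m) (f m)"
proof -
  have "mat_app (upper_bidiagonal N a) f m =
      (\<Sum>k<N. (if k = Suc m then f (Suc m) else 0) + (if k = m then smult (a m) (f m) else 0))"
    using assms unfolding mat_app_def upper_bidiagonal_def by (auto intro!: sum.cong)
  also have "\<dots> = f (Suc m) + smult (a m) (f m)"
    using assms by (simp add: sum.distrib)
  finally show ?thesis .
qed

lemma monom_pcompose_cancel:
  fixes p q :: "real poly"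
  assumes "monom 1 s * pcompose p (monom 1 (d + 1)) = monom 1 s * pcompose q (monom 1 (d + 1))"
  shows "p = q"
proof -
  have "pcompose (p - q) (monom 1 (d + 1)) = 0"
    using assms by (simp add: pcompose_diff)
  then have "p - q = 0" by (rule pcompose_eq_0) (simp add: degree_monom_eq)
  then show ?thesis by simp
qed

section \<open>Recurrences linking the components\<close>

locale symmetric_d_ops =
  fixes d :: nat and \<rho> :: "nat \<Rightarrow> real" and B :: "nat \<Rightarrow> real poly"
  assumes d: "1 \<le> d" and \<rho>_pos: "\<And>n. 1 \<le> n \<Longrightarrow> 0 < \<rho> n"
    and init: "\<And>n. n \<le> d \<Longrightarrow> B n = monom 1 n"
    and rec: "\<And>n. B (n + d + 1) = [:0, 1:] * B (n + d) - smult (\<rho> (n + 1)) (B n)"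
begin

abbreviation P :: "nat \<Rightarrow> nat \<Rightarrow> real poly" where
  "P s \<equiv> component d B s"

lemma is_component_P: "s \<le> d \<Longrightarrow> is_component d B s (P s)"
  unfolding component_def by (rule theI'[OF component_ex1[OF init rec]])

lemma monic_P: "s \<le> d \<Longrightarrow> monic_poly_seq (P s)"
  using is_component_P unfolding is_component_def by blast

lemma P_0:
  assumes "s \<le> d"
  shows "P s 0 = 1"
  using monic_P[OF assms] unfolding monic_poly_seq_def
  by (metis degree_eq_zeroE lead_coeff_pCons(2) one_pCons)

text \<open>The components are interleaved in the order in which they occur in \<open>B\<close>,
  which turns their mutual relations into one scalar recurrence.\<close>

definition Q :: "nat \<Rightarrow> real poly" where
  "Q m = P (m mod (d + 1)) (m div (d + 1))"

lemma Q_eq_P: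
  assumes "s \<le> d"
  shows "Q ((d + 1) * n + s) = P s n"
proof -
  have "(d + 1) * n + s = s + n * (d + 1)" by simp
  then show ?thesis
    using assms div_block[of s "d + 1" n] mod_block[of s "d + 1" n] unfolding Q_def
    by (simp only: less_Suc_eq_le Suc_eq_plus1[symmetric])
qed

lemma B_eq_Q: "B m = monom 1 (m mod (d + 1)) * pcompose (Q m) (monom 1 (d + 1))"
proof -
  have "m mod (d + 1) \<le> d" using mod_less_divisor[of "d + 1" m] by linarith
  from is_component_P[OF this, unfolded is_component_def, THEN conjunct2, rule_format, of "m div (d + 1)"]
  show ?thesis unfolding Q_def mult_div_mod_eq .
qed

text \<open>Cancel \<open>x^s\<close> in the recurrence of \<open>B\<close>, where \<open>s\<close>
  is the residue of \<open>n\<close>. The product \<open>x * B (n + d)\<close> has the factor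
  \<open>x * x^(s-1)\<close> for \<open>s > 0\<close>, but \<open>x * x^d\<close>, the new variable,
  for \<open>s = 0\<close>.\<close>

lemma Q_rec: "Q (n + d + 1) =
  (if n mod (d + 1) = 0 then [:0, 1:] * Q (n + d) else Q (n + d)) - smult (\<rho> (n + 1)) (Q n)"
proof -
  define s where "s = n mod (d + 1)"
  define q where "q = n div (d + 1)"
  let ?w = "monom 1 (d + 1) :: real poly"
  have n_eq: "n = (d + 1) * q + s" unfolding q_def s_def by (simp only: mult_div_mod_eq)
  have sd: "s \<le> d" unfolding s_def using mod_less_divisor[of "d + 1" n] by linarith
  have X: "[:0, 1:] = (monom 1 1 :: real poly)" by (simp add: monom_Suc)
  have k_mod: "(n + d + 1) mod (d + 1) = s"
    unfolding s_def using mod_add_self2[of n "d + 1"] by (simp only: add.assoc)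
  have "[:0, 1:] * B (n + d) =
    monom 1 s * pcompose (if s = 0 then [:0, 1:] * Q (n + d) else Q (n + d)) ?w"
  proof (cases "s = 0")
    case True
    have "n + d = d + q * (d + 1)" using n_eq True by simp
    then have "(n + d) mod (d + 1) = d" using mod_block[of d "d + 1" q] by (simp only:)
    then have "[:0, 1:] * B (n + d) = (monom 1 1 * monom 1 d) * pcompose (Q (n + d)) ?w"
      unfolding B_eq_Q[of "n + d"] X by (simp only: mult.assoc)
    also have "monom 1 1 * monom 1 d = pcompose [:0, 1:] ?w"
      by (simp add: mult_monom pcompose_pCons)
    finally show ?thesis unfolding True by (simp add: pcompose_mult)
  next
    case False
    have lt: "s - 1 < d + 1" using sd by simp
    have "n + d = (s - 1) + (q + 1) * (d + 1)" using n_eq False by simp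
    then have "(n + d) mod (d + 1) = s - 1" using mod_block[OF lt, of "q + 1"] by (simp only:)
    then have "[:0, 1:] * B (n + d) = (monom 1 1 * monom 1 (s - 1)) * pcompose (Q (n + d)) ?w"
      unfolding B_eq_Q[of "n + d"] X by (simp only: mult.assoc)
    then show ?thesis using False by (simp add: mult_monom)
  qed
  then have "B (n + d + 1) = monom 1 s * pcompose
      ((if s = 0 then [:0, 1:] * Q (n + d) else Q (n + d)) - smult (\<rho> (n + 1)) (Q n)) ?w"
    unfolding rec B_eq_Q[of n] s_def[symmetric]
    by (simp only: pcompose_diff pcompose_smult right_diff_distrib mult_smult_right)
  moreover have "B (n + d + 1) = monom 1 s * pcompose (Q (n + d + 1)) ?w"
    using B_eq_Q[of "n + d + 1"] unfolding k_mod .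
  ultimately show ?thesis unfolding s_def by (metis monom_pcompose_cancel)
qed

sublocale quotient_recurrence d \<rho> Q
proof
  show "Q n = 1" if "n \<le> d" for n
    using Q_eq_P[OF that, of 0] P_0[OF that] by simp
qed (use d \<rho>_pos Q_rec in auto)

lemma P_step:
  assumes "s < d"
  shows "P s n = P (Suc s) n +
    (case n of 0 \<Rightarrow> 0 | Suc k \<Rightarrow> smult (\<rho> ((d + 1) * k + Suc s + 1)) (P (Suc s) k))"
proof (cases n)
  case 0
  then show ?thesis using assms P_0[of s] P_0[of "Suc s"] by simp
next
  case (Suc k)
  \<comment> \<open>With this index, \<open>m + d + 1\<close> and \<open>m + d\<close> belong to
    components \<open>Suc s\<close> and \<open>s\<close>, both at degree
    \<open>Suc k\<close>.\<close>
  define m where "m = (d + 1) * k + Suc s"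
  have "m = Suc s + k * (d + 1)" unfolding m_def by simp
  then have "m mod (d + 1) = Suc s" using mod_block[of "Suc s" "d + 1" k] assms by simp
  moreover have "m + d + 1 = (d + 1) * Suc k + Suc s" "m + d = (d + 1) * Suc k + s"
    unfolding m_def by simp_all
  ultimately have "Q ((d + 1) * Suc k + Suc s) =
      Q ((d + 1) * Suc k + s) - smult (\<rho> (m + 1)) (Q m)"
    using Q_rec[of m] by (simp only: nat.distinct if_False)
  then have "P (Suc s) (Suc k) = P s (Suc k) - smult (\<rho> (m + 1)) (P (Suc s) k)"
    unfolding m_def using assms by (simp only: Q_eq_P less_imp_le Suc_le_eq)
  then show ?thesis unfolding Suc m_def by simp
qed

lemma P_wrap: "[:0, 1:] * P d n = P 0 (Suc n) + smult (\<rho> ((d + 1) * n + 1)) (P 0 n)"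
proof -
  define m where "m = (d + 1) * n"
  have "m mod (d + 1) = 0" unfolding m_def by (rule mod_mult_self1_is_0)
  moreover have "m + d + 1 = (d + 1) * Suc n + 0" unfolding m_def by simp
  ultimately have "Q ((d + 1) * Suc n + 0) =
      [:0, 1:] * Q (m + d) - smult (\<rho> (m + 1)) (Q (m + 0))"
    using Q_rec[of m] by (simp only: add_0_right simp_thms if_True)
  then have "P 0 (Suc n) = [:0, 1:] * P d n - smult (\<rho> (m + 1)) (P 0 n)"
    unfolding m_def by (simp only: Q_eq_P le0 order_refl)
  then show ?thesis unfolding m_def by simp
qed

section \<open>The cyclic product of bidiagonal factors\<close>

text \<open>For \<open>1 \<le> s \<le> d\<close> this carries component \<open>s\<close> to
  component \<open>s - 1\<close>, encoding \<open>P_step\<close>; \<open>U\<close> encodes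
  \<open>P_wrap\<close>.\<close>

definition L :: "nat \<Rightarrow> nat \<Rightarrow> real mat" where
  "L N s = lower_bidiagonal N (\<lambda>j. \<rho> ((d + 1) * j + s + 1))"

definition U :: "nat \<Rightarrow> real mat" where
  "U N = upper_bidiagonal N (\<lambda>j. \<rho> ((d + 1) * j + 1))"

primrec initial_product :: "nat \<Rightarrow> nat \<Rightarrow> real mat" where
  "initial_product N 0 = 1\<^sub>m N"
| "initial_product N (Suc i) = initial_product N i * L N (Suc i)"

text \<open>The product \<open>L_(d-j+1) ... L_d U L_1 ... L_i\<close>; for \<open>j = d - i\<close>
  the cycle closes at component \<open>i\<close>.\<close>

primrec cyclic_product :: "nat \<Rightarrow> nat \<Rightarrow> nat \<Rightarrow> real mat" where
  "cyclic_product N i 0 = U N * initial_product N i"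
| "cyclic_product N i (Suc j) = L N (d - j) * cyclic_product N i j"

lemma L_tn: "tn_principal N (L N s)" "lowers N (L N s)"
  unfolding L_def by (rule lower_bidiagonal_tn; simp add: \<rho>_pos)+

lemma U_tn: "tn_principal N (U N)" "raises N (U N)"
  unfolding U_def by (rule upper_bidiagonal_tn; simp add: \<rho>_pos)+

lemma initial_product_tn: "tn_principal N (initial_product N i)"
proof (induction i)
  case 0
  show ?case using tn_principal_power[OF U_tn(1)[of N], of 0]
    by (simp add: U_def upper_bidiagonal_def)
qed (simp add: tn_principal_mult L_tn)

lemma cyclic_product_tn: "tn_principal N (cyclic_product N i j)"
  by (induction j) (simp_all add: tn_principal_mult L_tn U_tn initial_product_tn)

lemma cyclic_product_raises: "raises N (cyclic_product N i j)"
  by (induction j)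
    (simp_all add: raises_mult cyclic_product_tn L_tn U_tn initial_product_tn)

text \<open>At least one lower bidiagonal factor has to occur; for \<open>j = d - i\<close> this
  follows from \<open>d \<ge> 1\<close>.\<close>

lemma cyclic_product_lowers:
  assumes "0 < i \<or> 0 < j"
  shows "lowers N (cyclic_product N i j)"
proof (cases j)
  case 0
  then obtain i' where "i = Suc i'" using assms by (cases i) auto
  then have "lowers N (initial_product N i)"
    by (simp add: lowers_mult initial_product_tn L_tn)
  then show ?thesis by (simp add: 0 lowers_mult U_tn initial_product_tn)
next
  case (Suc j')
  then show ?thesis by (simp add: lowers_mult cyclic_product_tn L_tn)
qed

lemma product_carrier [simp]:
  "L N s \<in> carrier_mat N N" "U N \<in> carrier_mat N N"
  "initial_product N i \<in> carrier_mat N N" "cyclic_product N i j \<in> carrier_mat N N"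
  using L_tn(1)[of N s] U_tn(1)[of N] initial_product_tn[of N i] cyclic_product_tn[of N i j]
  unfolding tn_principal_def by simp_all

lemma mat_app_L:
  assumes "s < d" "m < N"
  shows "mat_app (L N (Suc s)) (P (Suc s)) m = P s m"
  unfolding L_def mat_app_lower_bidiagonal[OF assms(2)] P_step[OF assms(1)] ..

lemma mat_app_initial_product:
  assumes "i \<le> d" "m < N"
  shows "mat_app (initial_product N i) (P i) m = P 0 m"
  using assms
proof (induction i arbitrary: m)
  case 0
  have "mat_app (1\<^sub>m N) (P 0) m = (\<Sum>k<N. if k = m then P 0 m else 0)"
    using 0 unfolding mat_app_def by (intro sum.cong) auto
  then show ?case using 0 by simp
next
  case (Suc i)
  have "mat_app (initial_product N (Suc i)) (P (Suc i)) m =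
      mat_app (initial_product N i) (mat_app (L N (Suc i)) (P (Suc i))) m"
    by (simp add: mat_app_mult[of _ N] Suc.prems)
  also have "\<dots> = mat_app (initial_product N i) (P i) m"
    using Suc.prems carrier_matD(2)[OF product_carrier(3), of N i]
    by (intro mat_app_cong mat_app_L) auto
  finally show ?case using Suc by simp
qed

text \<open>Truncation to size \<open>N\<close> destroys the upper bidiagonal factor only in its last row.\<close>

lemma mat_app_cyclic_product:
  assumes "i \<le> d" "j \<le> d" "Suc m < N"
  shows "mat_app (cyclic_product N i j) (P i) m = [:0, 1:] * P (d - j) m"
  using assms(2,3)
proof (induction j arbitrary: m)
  case 0
  have "mat_app (cyclic_product N i 0) (P i) m =
      mat_app (U N) (mat_app (initial_product N i) (P i)) m"
    using 0 by (simp add: mat_app_mult[of _ N])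
  also have "\<dots> = mat_app (U N) (P 0) m"
    using carrier_matD(2)[OF product_carrier(2), of N] assms(1)
    by (intro mat_app_cong mat_app_initial_product) auto
  finally show ?case
    unfolding U_def mat_app_upper_bidiagonal[OF 0(2)] P_wrap diff_zero .
next
  case (Suc j)
  define s where "s = d - Suc j"
  have s: "d - j = Suc s" "s < d" using Suc.prems unfolding s_def by auto
  have "mat_app (cyclic_product N i (Suc j)) (P i) m =
      mat_app (L N (Suc s)) (mat_app (cyclic_product N i j) (P i)) m"
    using Suc.prems by (simp add: mat_app_mult[of _ N] s)
  \<comment> \<open>Row \<open>m\<close> of the lower bidiagonal factor reads only the entries
    \<open>m\<close> and \<open>m - 1\<close>, which truncation has not damaged.\<close>
  also have "\<dots> = mat_app (L N (Suc s)) (\<lambda>k. [:0, 1:] * P (Suc s) k) m"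
    using Suc.prems Suc.IH unfolding L_def s
    by (simp add: mat_app_lower_bidiagonal split: nat.split)
  also have "\<dots> = [:0, 1:] * mat_app (L N (Suc s)) (P (Suc s)) m"
    unfolding mat_app_def by (simp only: sum_distrib_left mult_smult_right)
  finally show ?case using Suc.prems s by (simp add: mat_app_L s_def)
qed

text \<open>At size \<open>Suc n\<close> truncation spoils only the last row, so the first
  \<open>n\<close> rows are genuine expansions in the component, and such expansions are
  unique.\<close>

lemma leading_principal_eq:
  assumes "i \<le> d"
  shows "leading_principal n (monic_hessenberg (P i)) =
    mat n n (\<lambda>(k, l). cyclic_product (Suc n) i (d - i) $$ (k, l))"
proof -
  have "monic_hessenberg (P i) k l = cyclic_product (Suc n) i (d - i) $$ (k, l)"
    if "k < n" "l < n" for k l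
  proof (rule monic_hessenberg_unique[OF monic_P[OF assms] that(1)])
    have "mat_app (cyclic_product (Suc n) i (d - i)) (P i) k = [:0, 1:] * P i k"
      using mat_app_cyclic_product[of i "d - i" k "Suc n"] assms that by simp
    then show "[:0, 1:] * P i k =
        (\<Sum>l\<le>n. smult (cyclic_product (Suc n) i (d - i) $$ (k, l)) (P i l))"
      using carrier_matD(2)[OF product_carrier(4), of "Suc n" i "d - i"]
      unfolding mat_app_def by (simp only: lessThan_Suc_atMost)
  qed (use that in simp)
  then show ?thesis unfolding leading_principal_def by (intro cong_mat) auto
qed

section \<open>Oscillation and spectrum of the leading blocks\<close>

lemma oscillation_leading:
  assumes "i \<le> d"
  shows "oscillation_matrix (leading_principal n (monic_hessenberg (P i)))"
  unfolding leading_principal_eq[OF assms]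
  using d assms
  by (intro oscillation_matrixI[of n] leading_tn_principal[of "Suc n"] leading_raises_lowers[of _ "Suc n"]
      cyclic_product_tn cyclic_product_raises cyclic_product_lowers product_carrier) auto

lemma eigenvalues_leading:
  assumes "i \<le> d" "1 \<le> n"
  shows "eigenvalues_positive_simple (leading_principal n (monic_hessenberg (P i)))"
  using rsquarefree[of "(d + 1) * n + i"] root_positive[of "(d + 1) * n + i"]
  unfolding Q_eq_P[OF assms(1)]
  by (rule eigenvalues_positive_simple_leading[OF monic_P[OF assms(1)] assms(2)])

end

theorem mainTheorem5:
  fixes d :: nat and \<rho> :: "nat \<Rightarrow> real" and B :: "nat \<Rightarrow> real poly"
  assumes "d \<ge> 1"
    and "\<And>n. n \<ge> 1 \<Longrightarrow> \<rho> n > 0"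
    and "\<And>n. n \<le> d \<Longrightarrow> B n = monom 1 n"
    and "\<And>n. B (n + d + 1) = [:0, 1:] * B (n + d) - smult (\<rho> (n + 1)) (B n)"
  shows "\<forall>i\<le>d. \<forall>n\<ge>1.
    oscillation_matrix (leading_principal n (monic_hessenberg (component d B i))) \<and>
    eigenvalues_positive_simple (leading_principal n (monic_hessenberg (component d B i)))"
proof -
  interpret symmetric_d_ops d \<rho> B by unfold_locales (use assms in auto)
  show ?thesis using oscillation_leading eigenvalues_leading by blast
qed

end
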